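(* Let $(1,r,a,t)$ be a level $h$-vector such that $$t(r-2t)+3\leq a\leq \binom{r+1}{2}-1 \quad\text{and}\quad r\geq t(a-t)+2.$$ Then $(1,r,a+1,t)$ is also a level $h$-vector.
   Context: Let $k$ be a field of characteristic zero. All algebras are standard graded artinian algebras $A=R/I$, where $R=k[x_1,\dots,x_r]$, all $x_i$ have degree $1$, and $I$ is a homogeneous ideal of $R$ containing no nonzero forms of degree $1$. The $h$-vector of $A$ is $h(A)=(h_0,h_1,\dots,h_e)$, where $h_i=\dim_k A_i$ and $e$ is the last index with $\dim_k A_e>0$; thus $h_0=1$ and $h_1=r$. The integer $e$ is the socle degree. The socle of $A$ is the annihilator in $A$ of its homogeneous maximal ideal. $A$ is level of type $t$ if its socle is concentrated in degree $e$ and has dimension $t=h_e$. An $h$-vector is level if it is the $h$-vector of some level standard graded artinian algebra $A=k[x_1,\dots,x_r]/I$, where all $x_i$ have degree $1$ and $I$ is a homogeneous ideal containing no nonzero forms of degree $1$. *)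

theory Defs
  imports "HOL-Algebra.Algebra" "HOL-Library.Poly_Mapping"
begin

text \<open>
  A monomial is an exponent vector of type \<open>nat \<Rightarrow>\<^sub>0 nat\<close>, and a polynomial over \<open>k\<close> maps
  monomials to coefficients with finite support. The variables of \<open>k[x\<^sub>1,\<dots>,x\<^sub>r]\<close> are indexed
  by \<open>0,\<dots>,r - 1\<close>; since the type provides infinitely many variables, the carrier restricts
  to polynomials in which only these \<open>r\<close> variables occur.
\<close>

type_synonym 'k mpoly = "(nat \<Rightarrow>\<^sub>0 nat) \<Rightarrow>\<^sub>0 'k"

definition mdeg :: "(nat \<Rightarrow>\<^sub>0 nat) \<Rightarrow> nat"
  where "mdeg m = (\<Sum>i\<in>Poly_Mapping.keys m. Poly_Mapping.lookup m i)"

definition mpoly_ring :: "nat \<Rightarrow> 'k::field mpoly ring"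
  where "mpoly_ring r =
    \<lparr>carrier = {p. \<forall>m\<in>Poly_Mapping.keys p. Poly_Mapping.keys m \<subseteq> {..<r}},
     monoid.mult = (*), one = 1, ring.zero = 0, ring.add = (+)\<rparr>"

lemma cring_mpoly_ring: "cring (mpoly_ring r :: 'k::field mpoly ring)"
proof (rule cringI)
  show "abelian_group (mpoly_ring r :: 'k mpoly ring)"
  proof (rule abelian_groupI)
    fix p q :: "'k mpoly"
    assume "p \<in> carrier (mpoly_ring r)" "q \<in> carrier (mpoly_ring r)"
    then show "p \<oplus>\<^bsub>mpoly_ring r\<^esub> q \<in> carrier (mpoly_ring r)"
      using Poly_Mapping.keys_add[of p q] by (fastforce simp: mpoly_ring_def)
  next
    fix p :: "'k mpoly"
    assume "p \<in> carrier (mpoly_ring r)"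
    then have "- p \<in> carrier (mpoly_ring r)" "- p \<oplus>\<^bsub>mpoly_ring r\<^esub> p = \<zero>\<^bsub>mpoly_ring r\<^esub>"
      by (auto simp: mpoly_ring_def)
    then show "\<exists>q\<in>carrier (mpoly_ring r). q \<oplus>\<^bsub>mpoly_ring r\<^esub> p = \<zero>\<^bsub>mpoly_ring r\<^esub>"
      by blast
  qed (auto simp: mpoly_ring_def algebra_simps)
next
  show "Group.comm_monoid (mpoly_ring r :: 'k mpoly ring)"
  proof (rule comm_monoidI)
    fix p q :: "'k mpoly"
    assume p: "p \<in> carrier (mpoly_ring r)" and q: "q \<in> carrier (mpoly_ring r)"
    have "Poly_Mapping.keys m \<subseteq> {..<r}" if "m \<in> Poly_Mapping.keys (p * q)" for m
    proof -
      from that obtain a b where "m = a + b" "a \<in> Poly_Mapping.keys p" "b \<in> Poly_Mapping.keys q"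
        using Poly_Mapping.keys_mult[of p q] by blast
      then show ?thesis
        using p q Poly_Mapping.keys_add[of a b] by (fastforce simp: mpoly_ring_def)
    qed
    then show "p \<otimes>\<^bsub>mpoly_ring r\<^esub> q \<in> carrier (mpoly_ring r)"
      by (simp add: mpoly_ring_def)
  qed (auto simp: mpoly_ring_def algebra_simps)
qed (auto simp: mpoly_ring_def algebra_simps)

text \<open>The graded piece of forms of degree \<open>d\<close>, including \<open>0\<close>.\<close>

definition forms :: "nat \<Rightarrow> nat \<Rightarrow> 'k::field mpoly set"
  where "forms r d = {p \<in> carrier (mpoly_ring r). \<forall>m\<in>Poly_Mapping.keys p. mdeg m = d}"

definition hom_component :: "nat \<Rightarrow> 'k::field mpoly \<Rightarrow> 'k mpoly"
  where "hom_component d p = Poly_Mapping.mapp (\<lambda>m c. c when mdeg m = d) p"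

definition homogeneous_ideal :: "nat \<Rightarrow> 'k::field mpoly set \<Rightarrow> bool"
  where "homogeneous_ideal r I \<longleftrightarrow>
    ideal I (mpoly_ring r) \<and> (\<forall>p\<in>I. \<forall>d. hom_component d p \<in> I)"

definition artinian :: "('a, 'b) ring_scheme \<Rightarrow> bool"
  where "artinian A \<longleftrightarrow> ring A \<and>
    (\<forall>J :: nat \<Rightarrow> 'a set. (\<forall>n. ideal (J n) A) \<and> (\<forall>n. J (Suc n) \<subseteq> J n)
      \<longrightarrow> (\<exists>N. \<forall>n\<ge>N. J n = J N))"

text \<open>
  The algebra \<open>A = R/I\<close> is the library's quotient ring, whose elements are the cosets of \<open>I\<close>.
  The base field sits inside \<open>A\<close> as the image of the constant polynomials, and dimensions are
  taken over this subfield.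
\<close>

definition quot_alg :: "nat \<Rightarrow> 'k::field mpoly set \<Rightarrow> 'k mpoly set ring"
  where "quot_alg r I = mpoly_ring r Quot I"

definition residue_class :: "nat \<Rightarrow> 'k::field mpoly set \<Rightarrow> 'k mpoly \<Rightarrow> 'k mpoly set"
  where "residue_class r I p = I +>\<^bsub>mpoly_ring r\<^esub> p"

definition base_field :: "nat \<Rightarrow> 'k::field mpoly set \<Rightarrow> 'k mpoly set set"
  where "base_field r I = residue_class r I ` range (Poly_Mapping.single 0)"

definition kdim :: "nat \<Rightarrow> 'k::field mpoly set \<Rightarrow> 'k mpoly set set \<Rightarrow> nat"
  where "kdim r I V = ring.dim (quot_alg r I) (base_field r I) V"

definition graded_piece :: "nat \<Rightarrow> 'k::field mpoly set \<Rightarrow> nat \<Rightarrow> 'k mpoly set set"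
  where "graded_piece r I d = residue_class r I ` forms r d"

text \<open>
  \<open>I\<close> is required to be proper, so that \<open>A\<close> is nonzero and \<open>h\<^sub>0 = 1\<close>. For \<open>r > 0\<close> this
  already follows from the absence of linear forms.
\<close>

definition standard_graded_artinian :: "nat \<Rightarrow> 'k::field mpoly set \<Rightarrow> bool"
  where "standard_graded_artinian r I \<longleftrightarrow>
    homogeneous_ideal r I \<and> I \<noteq> carrier (mpoly_ring r) \<and> I \<inter> forms r 1 = {0} \<and>
    artinian (quot_alg r I)"

definition hilb :: "nat \<Rightarrow> 'k::field mpoly set \<Rightarrow> nat \<Rightarrow> nat"
  where "hilb r I i = kdim r I (graded_piece r I i)"

definition socle_degree :: "nat \<Rightarrow> 'k::field mpoly set \<Rightarrow> nat"
  where "socle_degree r I = (GREATEST e. hilb r I e > 0)"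

definition h_vector :: "nat \<Rightarrow> 'k::field mpoly set \<Rightarrow> nat list"
  where "h_vector r I = map (hilb r I) [0..<Suc (socle_degree r I)]"

text \<open>The homogeneous maximal ideal: residue classes of polynomials without constant term.\<close>

definition hom_max_ideal :: "nat \<Rightarrow> 'k::field mpoly set \<Rightarrow> 'k mpoly set set"
  where "hom_max_ideal r I =
    residue_class r I ` {p \<in> carrier (mpoly_ring r). Poly_Mapping.lookup p 0 = 0}"

definition socle :: "nat \<Rightarrow> 'k::field mpoly set \<Rightarrow> 'k mpoly set set"
  where "socle r I =
    {s \<in> carrier (quot_alg r I). \<forall>m\<in>hom_max_ideal r I. s \<otimes>\<^bsub>quot_alg r I\<^esub> m = \<zero>\<^bsub>quot_alg r I\<^esub>}"

definition level_of_type :: "nat \<Rightarrow> 'k::field mpoly set \<Rightarrow> nat \<Rightarrow> bool"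
  where "level_of_type r I t \<longleftrightarrow>
    socle r I \<subseteq> graded_piece r I (socle_degree r I) \<and>
    kdim r I (socle r I) = t \<and> t = hilb r I (socle_degree r I)"

definition level_h_vector :: "'k::field itself \<Rightarrow> nat list \<Rightarrow> bool"
  where "level_h_vector (_ :: 'k itself) h \<longleftrightarrow>
    (\<exists>r (I :: 'k mpoly set).
      standard_graded_artinian r I \<and> (\<exists>t. level_of_type r I t) \<and> h_vector r I = h)"

end

theory Submission
  imports Defs
begin

text \<open>
  The numerical hypotheses force \<open>a \<le> t + 1\<close>. Then some cubic \<open>g \<notin> I\<^sub>3\<close> has the property that no
  quadric \<open>p \<notin> I\<^sub>2\<close> satisfies \<open>R\<^sub>1 p \<subseteq> I\<^sub>3 + \<langle>g\<rangle>\<close>: otherwise a basis \<open>g\<^sub>i\<close> of \<open>A\<^sub>3\<close> would give \<open>t\<close>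
  independent elements \<open>p\<^sub>i\<close> of \<open>A\<^sub>2\<close> with \<open>x p\<^sub>i = \<lambda>\<^sub>i(x) g\<^sub>i\<close>, which leaves only \<open>a = t\<close> and
  \<open>a = t + 1\<close>, and there some linear form \<open>x \<noteq> 0\<close> would annihilate \<open>A\<^sub>2\<close>, contradicting levelness.
  As \<open>I\<^sub>2 \<noteq> 0\<close>, some point \<open>c\<close> is not a zero of all of \<open>I\<^sub>2\<close>. Replacing \<open>I\<^sub>2\<close> and \<open>I\<^sub>3 + \<langle>g\<rangle>\<close> by
  their subspaces of forms vanishing at \<open>c\<close> keeps the algebra level, raises \<open>h\<^sub>2\<close> by one and leaves
  \<open>h\<^sub>3\<close> unchanged.
\<close>

section \<open>Linear functionals and finite dimension\<close>

text \<open>Imposing the point \<open>c\<close> on \<open>I_2\<close> and \<open>I_3\<close> alone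
  would raise \<open>h_3\<close> together with \<open>h_2\<close>; the cubic \<open>g\<close> is
  adjoined beforehand to compensate in degree 3. The danger is that \<open>g\<close> creates socle
  in degree 2, and the property demanded of \<open>g\<close> says exactly that it does not.
  Vanishing at \<open>c\<close> creates none either: evaluation is multiplicative, so a linear form
  that is nonzero at \<open>c\<close> recovers the vanishing of \<open>p\<close> from that of its
  multiples.

  The annihilating linear form always comes from counting: fewer than \<open>r\<close> functionals
  on \<open>R_1\<close> have a common nonzero zero. For \<open>a = t\<close> the \<open>lam\<close>
  functionals turn out proportional, so one of them suffices. For \<open>a = t + 1\<close> a further
  quadric \<open>q\<close> brings its own functional for each basis cubic. The resulting
  \<open>2 * t\<close> functionals are too many in general; the symmetry of \<open>x * y * z\<close>
  cuts them down to \<open>t + 1\<close>, and \<open>r\<close> is at least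
  \<open>t + 2\<close>.\<close>

locale linear_space = vector_space scale
  for scale :: "'a::field \<Rightarrow> 'b::ab_group_add \<Rightarrow> 'b"
begin

definition functional :: "('b \<Rightarrow> 'a) \<Rightarrow> bool"
  where "functional f \<longleftrightarrow> (\<forall>x y. f (x + y) = f x + f y) \<and> (\<forall>c x. f (scale c x) = c * f x)"

lemma functional_0: "functional f \<Longrightarrow> f 0 = 0"
  using functional_def[of f] by (metis add_cancel_right_right)

lemma functional_diff: "functional f \<Longrightarrow> f (x - y) = f x - f y"
  using functional_def[of f] by (metis add_diff_cancel diff_add_cancel)

lemma functional_diff_mult:
  "functional f \<Longrightarrow> functional g \<Longrightarrow> functional (\<lambda>x. f x - g x * c)"
  by (simp add: functional_def algebra_simps)

lemma functional_zero_on_span: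
  assumes "functional f" "\<And>x. x \<in> S \<Longrightarrow> f x = 0" "x \<in> span S"
  shows "f x = 0"
  using assms(3)
proof (induction rule: span_induct_alt)
  case base
  then show ?case using functional_0[OF assms(1)] .
next
  case (step c x y)
  then show ?case using assms(1,2) by (simp add: functional_def)
qed

lemma functional_extend:
  assumes "independent B"
  shows "\<exists>f. functional f \<and> (\<forall>x\<in>B. f x = g x)"
proof -
  interpret vector_space_pair scale "(*)"
    by (unfold_locales) (simp_all add: algebra_simps)
  show ?thesis using linear_independent_extend[OF assms]
    unfolding functional_def Vector_Spaces.linear_iff by blast
qed

lemma subspace_ker: "subspace S \<Longrightarrow> functional f \<Longrightarrow> subspace {x \<in> S. f x = 0}"
  using functional_0[of f] by (auto simp: subspace_def functional_def)

text \<open>The space of all polynomials has infinite dimension, where \<open>dim\<close> carries no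
  information. Hence this and the following lemmas take a finite \<open>W\<close> whose span
  contains the subspace in question.\<close>

lemma finite_basis:
  assumes "S \<subseteq> span W" "finite W"
  obtains B where "B \<subseteq> S" "independent B" "S \<subseteq> span B" "finite B" "card B = dim S"
  using assms basis_exists[of S] independent_span_bound[of W] by (metis subset_trans)

lemma finite_independent_in:
  assumes "S \<subseteq> span W" "finite W" "independent B" "B \<subseteq> S"
  shows "finite B \<and> card B \<le> dim S"
proof -
  obtain C where "C \<subseteq> S" "S \<subseteq> span C" "finite C" "card C = dim S"
    using finite_basis[OF assms(1,2)] by metis
  then show ?thesis using independent_span_bound[of C B] assms by auto
qed

lemma dim_mono_fin:
  assumes "S \<subseteq> T" "T \<subseteq> span W" "finite W"
  shows "dim S \<le> dim T"
  using assms finite_basis[of S W] finite_independent_in[of T W] by (metis subset_trans)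

lemma dim_insert_notin:
  assumes "subspace U" "U \<subseteq> span W" "finite W" "g \<notin> U"
  shows "dim (span (insert g U)) = Suc (dim U)"
proof -
  obtain B where B: "B \<subseteq> U" "independent B" "U \<subseteq> span B" "finite B" "card B = dim U"
    using finite_basis[OF assms(2,3)] by metis
  have sB: "span B = U"
    using B assms(1) by (metis span_minimal subset_antisym)
  have "independent (insert g B)"
    using B assms(4) sB by (simp add: independent_insertI)
  moreover have "span (insert g B) = span (insert g U)"
  proof (rule span_unique)
    show "insert g B \<subseteq> span (insert g U)" using B by (auto intro: span_base)
    show "subspace (span (insert g U))" by simp
    fix T assume "insert g B \<subseteq> T" "subspace T"
    then have "insert g U \<subseteq> T" using B span_minimal[of B T] by auto
    then show "span (insert g U) \<subseteq> T" using \<open>subspace T\<close> by (rule span_minimal)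
  qed
  moreover have "card (insert g B) = Suc (dim U)"
    using B assms(4) by (auto simp: card_insert_if)
  ultimately show ?thesis
    by (metis dim_span_eq_card_independent)
qed

lemma subspace_dim_eq_fin:
  assumes "subspace S" "S \<subseteq> T" "T \<subseteq> span W" "finite W" "dim T \<le> dim S"
  shows "S = T"
proof (rule ccontr)
  assume "S \<noteq> T"
  then obtain g where g: "g \<in> T" "g \<notin> S" using assms(2) by auto
  have "span (insert g S) \<subseteq> span T" using g assms(2) by (intro span_mono) auto
  then have "dim (span (insert g S)) \<le> dim T"
    using dim_mono_fin[of "span (insert g S)" "span T" W] assms(3,4)
      span_minimal[OF assms(3)] by simp
  then show False
    using dim_insert_notin[of S W g] assms g by auto
qed

text \<open>Subtracting \<open>f x / f v\<close> times \<open>v\<close> moves any \<open>x\<close>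
  into the kernel, so \<open>v\<close> alone completes the kernel to \<open>S\<close>.\<close>

lemma dim_ker:
  assumes "subspace S" "S \<subseteq> span W" "finite W" "functional f" "v \<in> S" "f v \<noteq> 0"
  shows "dim S = Suc (dim {x \<in> S. f x = 0})"
proof -
  let ?K = "{x \<in> S. f x = 0}"
  have "span (insert v ?K) = S"
  proof (rule span_unique)
    fix T assume T: "insert v ?K \<subseteq> T" "subspace T"
    show "S \<subseteq> T"
    proof
      fix x assume x: "x \<in> S"
      have "x - scale (f x / f v) v \<in> ?K"
        using x assms by (auto simp: functional_diff functional_def subspace_diff subspace_scale)
      then have "x - scale (f x / f v) v + scale (f x / f v) v \<in> T"
        using T by (metis insert_subset subsetD subspace_add subspace_scale)
      then show "x \<in> T" by simp
    qed
  qed (use assms in auto)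
  moreover have "dim (span (insert v ?K)) = Suc (dim ?K)"
    using assms by (intro dim_insert_notin[where W=W] subspace_ker) auto
  ultimately show ?thesis by simp
qed

text \<open>Each functional lowers the dimension by at most one. This is where lower bounds on
  \<open>r\<close> turn into nonzero linear forms.\<close>

lemma common_zero:
  assumes "finite M" "\<And>f. f \<in> M \<Longrightarrow> functional f"
    and "subspace S" "S \<subseteq> span W" "finite W" "card M < dim S"
  shows "\<exists>x\<in>S. x \<noteq> 0 \<and> (\<forall>f\<in>M. f x = 0)"
  using assms
proof (induction M arbitrary: S rule: finite_induct)
  case empty
  show ?case
  proof (rule ccontr)
    assume "\<not> ?thesis"
    then have "S \<subseteq> span {}" by auto
    then show False using dim_le_card[of S "{}"] empty by simp
  qed
next
  case (insert f M)
  let ?K = "{x \<in> S. f x = 0}"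
  have "card M < dim ?K"
  proof (cases "\<exists>v\<in>S. f v \<noteq> 0")
    case True
    then show ?thesis using dim_ker[of S W f] insert by auto
  next
    case False
    then have "?K = S" by auto
    then show ?thesis using insert by auto
  qed
  then have "\<exists>x\<in>?K. x \<noteq> 0 \<and> (\<forall>f\<in>M. f x = 0)"
    using insert by (intro insert.IH subspace_ker) auto
  then show ?case by auto
qed

text \<open>Coordinates on the quotient of \<open>F\<close> by \<open>U\<close> without forming it:
  \<open>G\<close> completes a basis of \<open>U\<close> to a basis of \<open>F\<close>, and
  \<open>f g\<close> extends the coordinate of \<open>g\<close> to the whole space.\<close>

lemma quotient_coordinates:
  assumes "subspace U" "U \<subseteq> F" "subspace F" "F \<subseteq> span W" "finite W"
  obtains G f where "G \<subseteq> F" "finite G" "dim F = dim U + card G"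
    "\<And>g. functional (f g)"
    "\<And>g h. g \<in> G \<Longrightarrow> h \<in> G \<Longrightarrow> f g h = (if h = g then 1 else 0)"
    "\<And>p. p \<in> F \<Longrightarrow> p \<in> U \<longleftrightarrow> (\<forall>g\<in>G. f g p = 0)"
proof -
  have UW: "U \<subseteq> span W" using assms by auto
  obtain B where B: "B \<subseteq> U" "independent B" "U \<subseteq> span B" "finite B" "card B = dim U"
    using finite_basis[OF UW assms(5)] by metis
  obtain C where C: "B \<subseteq> C" "C \<subseteq> F" "independent C" "F \<subseteq> span C"
    using maximal_independent_subset_extend[of B F] B assms by (metis subset_trans)
  have fC: "finite C" "card C = dim F"
    using finite_independent_in[of F W C] basis_card_eq_dim[of C F] C assms by auto
  define G where "G = C - B"
  have "\<forall>g. \<exists>f. functional f \<and> (\<forall>x\<in>C. f x = (if x = g then 1 else 0))"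
    by (intro allI functional_extend[OF C(3)])
  then obtain f where f: "\<And>g. functional (f g)" "\<And>g x. x \<in> C \<Longrightarrow> f g x = (if x = g then 1 else 0)"
    by metis
  show thesis
  proof
    show "G \<subseteq> F" "finite G" using C fC by (auto simp: G_def)
    show "dim F = dim U + card G"
      using fC B C card_mono[of C B] by (simp add: G_def card_Diff_subset)
    show "functional (f g)" for g by (rule f)
    show "f g h = (if h = g then 1 else 0)" if "g \<in> G" "h \<in> G" for g h
      using f(2) that by (auto simp: G_def)
    fix p assume p: "p \<in> F"
    show "p \<in> U \<longleftrightarrow> (\<forall>g\<in>G. f g p = 0)"
    proof
      assume "p \<in> U"
      then have "p \<in> span B" using B by auto
      then show "\<forall>g\<in>G. f g p = 0"
        using functional_zero_on_span[OF f(1)] f(2) C(1) unfolding G_def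
        by (smt (verit, best) DiffE subsetD)
    next
      assume z: "\<forall>g\<in>G. f g p = 0"
      have "p \<in> span C" using p C by auto
      then have "\<exists>u. p = (\<Sum>c\<in>C. scale (u c) c)"
        using span_finite[OF fC(1)] by auto
      then obtain u where u: "p = (\<Sum>c\<in>C. scale (u c) c)" by auto
      have lin: "f g (\<Sum>c\<in>A. scale (u c) c) = (\<Sum>c\<in>A. u c * f g c)" if "finite A" for g A
        using that f(1)[of g] functional_0[OF f(1)] by induction (auto simp: functional_def)
      have "u g = 0" if "g \<in> G" for g
      proof -
        have "f g p = (\<Sum>c\<in>C. u c * f g c)" using u lin fC by simp
        also have "\<dots> = (\<Sum>c\<in>C. if c = g then u c else 0)" by (intro sum.cong) (auto simp: f(2))
        also have "\<dots> = u g" using that fC by (simp add: G_def)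
        finally show ?thesis using z that by simp
      qed
      then have "p = (\<Sum>c\<in>B. scale (u c) c)"
        unfolding u using fC C by (intro sum.mono_neutral_right) (auto simp: G_def)
      also have "\<dots> \<in> span B" by (intro span_sum span_scale span_base)
      also have "\<dots> \<subseteq> U" using B assms(1) by (intro span_minimal)
      finally show "p \<in> U" .
    qed
  qed
qed

text \<open>The \<open>P g\<close> are adjoined one at a time: \<open>f g\<close> kills
  \<open>U\<close> and every other \<open>P h\<close> but not \<open>P g\<close>, so each step adds
  a dimension.\<close>

lemma dim_span_Un_dual:
  assumes "subspace U" "U \<subseteq> span W" "finite W" "finite G" "P ` G \<subseteq> span W"
    "\<And>g. g \<in> G \<Longrightarrow> functional (f g)"
    "\<And>g u. g \<in> G \<Longrightarrow> u \<in> U \<Longrightarrow> f g u = 0"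
    "\<And>g h. g \<in> G \<Longrightarrow> h \<in> G \<Longrightarrow> f g (P h) = 0 \<longleftrightarrow> g \<noteq> h"
  shows "dim (span (U \<union> P ` G)) = dim U + card G"
  using assms(4-)
proof (induction rule: finite_induct)
  case empty
  then show ?case by simp
next
  case (insert g G)
  let ?V = "span (U \<union> P ` G)"
  have "f g x = 0" if "x \<in> ?V" for x
    using functional_zero_on_span[of "f g", OF _ _ that] insert.prems insert.hyps by fastforce
  then have "P g \<notin> ?V" using insert.prems(4)[of g g] by auto
  then have "dim (span (insert (P g) ?V)) = Suc (dim ?V)"
    using insert.prems assms(2,3) span_minimal[of "U \<union> P ` G" "span W"]
    by (intro dim_insert_notin[where W=W]) auto
  moreover have "span (insert (P g) ?V) = span (U \<union> P ` insert g G)"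
  proof (rule span_unique)
    show "insert (P g) ?V \<subseteq> span (U \<union> P ` insert g G)"
      using span_mono[of "U \<union> P ` G" "U \<union> P ` insert g G"] by (auto intro: span_base)
    fix T assume "insert (P g) ?V \<subseteq> T" "subspace T"
    moreover have "U \<union> P ` G \<subseteq> ?V" by (rule span_superset)
    ultimately show "span (U \<union> P ` insert g G) \<subseteq> T"
      by (intro span_minimal) auto
  qed simp
  ultimately show ?case using insert by simp
qed

end

section \<open>Forms and monomials\<close>

text \<open>Scaling is a product with a constant polynomial, so ring laws apply to it and every
  ideal is a subspace at once.\<close>

abbreviation pscale :: "'k::field \<Rightarrow> 'k mpoly \<Rightarrow> 'k mpoly"
  where "pscale c p \<equiv> Poly_Mapping.single 0 c * p"

interpretation mp: linear_space "pscale :: 'k::field \<Rightarrow> 'k mpoly \<Rightarrow> 'k mpoly"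
  by unfold_locales
    (simp_all add: distrib_left distrib_right single_add mult_single flip: mult.assoc)

lemma dim_zero: "mp.dim ({0} :: 'k::field mpoly set) = 0"
  using mp.dim_span[of "{} :: 'k mpoly set"] mp.dim_eq_card_independent[OF mp.independent_empty]
  by simp

abbreviation mon :: "(nat \<Rightarrow>\<^sub>0 nat) \<Rightarrow> 'k::field mpoly"
  where "mon m \<equiv> Poly_Mapping.single m 1"

lemma lookup_pscale [simp]: "Poly_Mapping.lookup (pscale c p) m = c * Poly_Mapping.lookup p m"
  unfolding mult_map_scale_conv_mult[symmetric] by (simp add: Poly_Mapping.map.rep_eq when_def)

lemma poly_eq_sum_mon:
  assumes "finite M" "Poly_Mapping.keys p \<subseteq> M"
  shows "p = (\<Sum>m\<in>M. pscale (Poly_Mapping.lookup p m) (mon m))"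
proof (rule poly_mapping_eqI)
  fix n
  have "Poly_Mapping.lookup (\<Sum>m\<in>M. pscale (Poly_Mapping.lookup p m) (mon m)) n
      = (\<Sum>m\<in>M. if m = n then Poly_Mapping.lookup p m else 0)"
    unfolding lookup_sum by (intro sum.cong) (auto simp: lookup_single when_def)
  then show "Poly_Mapping.lookup p n = Poly_Mapping.lookup (\<Sum>m\<in>M. pscale (Poly_Mapping.lookup p m) (mon m)) n"
    using assms by (auto simp: in_keys_iff)
qed

lemma in_span_mon_iff:
  "p \<in> mp.span (mon ` M) \<longleftrightarrow> Poly_Mapping.keys p \<subseteq> M"
proof
  assume "p \<in> mp.span (mon ` M)"
  then show "Poly_Mapping.keys p \<subseteq> M"
  proof (induction rule: mp.span_induct_alt)
    case (step c x y)
    then obtain m where m: "m \<in> M" "x = mon m" by auto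
    have "Poly_Mapping.keys (pscale c x + y) \<subseteq> Poly_Mapping.keys (pscale c x) \<union> Poly_Mapping.keys y"
      by (rule keys_add)
    also have "Poly_Mapping.keys (pscale c x) \<subseteq> {m}"
      using m by (auto simp: in_keys_iff lookup_single when_def split: if_splits)
    finally show ?case using m step by auto
  qed auto
next
  assume M: "Poly_Mapping.keys p \<subseteq> M"
  have "p = (\<Sum>m\<in>Poly_Mapping.keys p. pscale (Poly_Mapping.lookup p m) (mon m))"
    by (rule poly_eq_sum_mon) auto
  also have "\<dots> \<in> mp.span (mon ` M)"
    using M by (intro mp.span_sum mp.span_scale mp.span_base) auto
  finally show "p \<in> mp.span (mon ` M)" .
qed

lemma inj_mon: "inj_on (mon :: _ \<Rightarrow> 'k::field mpoly) M"
proof (rule inj_onI)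
  fix m n :: "nat \<Rightarrow>\<^sub>0 nat" assume "mon m = (mon n :: 'k mpoly)"
  then have "Poly_Mapping.keys (mon m :: 'k mpoly) = Poly_Mapping.keys (mon n :: 'k mpoly)" by simp
  then show "m = n" by simp
qed

lemma inj_single1: "inj_on (\<lambda>i::nat. Poly_Mapping.single i (1::nat)) M"
proof (rule inj_onI)
  fix i j :: nat assume "Poly_Mapping.single i (1::nat) = Poly_Mapping.single j 1"
  then have "Poly_Mapping.keys (Poly_Mapping.single i (1::nat)) = Poly_Mapping.keys (Poly_Mapping.single j (1::nat))" by simp
  then show "i = j" by simp
qed

lemma independent_mon:
  assumes "finite M"
  shows "mp.independent (mon ` M :: 'k::field mpoly set)"
proof (rule mp.independent_if_scalars_zero)
  fix f :: "'k mpoly \<Rightarrow> 'k" and x :: "'k mpoly"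
  assume 0: "(\<Sum>x\<in>mon ` M. pscale (f x) x) = 0" and x: "x \<in> mon ` M"
  from x obtain n where n: "n \<in> M" "x = mon n" by auto
  have z: "(\<Sum>m\<in>M. pscale (f (mon m)) (mon m)) = 0"
    using 0 unfolding sum.reindex[OF inj_mon] o_def .
  have "f x = (\<Sum>m\<in>M. if m = n then f (mon m) else 0)" using n assms by simp
  also have "\<dots> = Poly_Mapping.lookup (\<Sum>m\<in>M. pscale (f (mon m)) (mon m)) n"
    unfolding lookup_sum by (intro sum.cong) (auto simp: lookup_single when_def)
  also have "\<dots> = 0" by (simp only: z lookup_zero)
  finally show "f x = 0" .
qed (use assms in simp)

section \<open>Exponent vectors of a given degree and the dimensions of spaces of forms\<close>

definition expts :: "nat \<Rightarrow> nat \<Rightarrow> (nat \<Rightarrow>\<^sub>0 nat) set"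
  where "expts r d = {m. Poly_Mapping.keys m \<subseteq> {..<r} \<and> mdeg m = d}"

lemma mdeg_eq_sum:
  assumes "finite A" "Poly_Mapping.keys m \<subseteq> A"
  shows "mdeg m = (\<Sum>i\<in>A. Poly_Mapping.lookup m i)"
  unfolding mdeg_def using assms by (intro sum.mono_neutral_left) (auto simp: in_keys_iff)

lemma mdeg_add: "mdeg (m + n) = mdeg m + mdeg n"
proof -
  let ?A = "Poly_Mapping.keys m \<union> Poly_Mapping.keys n"
  have "mdeg (m + n) = (\<Sum>i\<in>?A. Poly_Mapping.lookup (m + n) i)"
    using keys_add[of m n] by (intro mdeg_eq_sum) auto
  also have "\<dots> = (\<Sum>i\<in>?A. Poly_Mapping.lookup m i) + (\<Sum>i\<in>?A. Poly_Mapping.lookup n i)"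
    by (simp add: lookup_add sum.distrib)
  finally show ?thesis by (simp add: mdeg_eq_sum[of ?A])
qed

lemma mdeg_single [simp]: "mdeg (Poly_Mapping.single i n) = n"
  by (cases "n = 0") (auto simp: mdeg_def)

lemma mdeg_eq_0_iff [simp]: "mdeg m = 0 \<longleftrightarrow> m = 0"
proof
  assume "mdeg m = 0"
  then show "m = 0" by (intro poly_mapping_eqI) (auto simp: mdeg_def in_keys_iff)
qed (simp add: mdeg_def)

lemma mdeg_0 [simp]: "mdeg 0 = 0"
  by simp

lemma finite_expts: "finite (expts r d)"
proof -
  let ?F = "{f :: nat \<Rightarrow> nat. \<forall>x. (x \<in> {..<r} \<longrightarrow> f x \<in> {..d}) \<and> (x \<notin> {..<r} \<longrightarrow> f x = 0)}"
  have "Poly_Mapping.lookup ` expts r d \<subseteq> ?F"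
  proof (intro image_subsetI CollectI allI conjI impI)
    fix m x assume m: "m \<in> expts r d"
    show "Poly_Mapping.lookup m x \<in> {..d}"
    proof (cases "x \<in> Poly_Mapping.keys m")
      case True
      then have "Poly_Mapping.lookup m x \<le> mdeg m"
        unfolding mdeg_def by (intro member_le_sum) auto
      then show ?thesis using m by (simp add: expts_def)
    qed (simp add: in_keys_iff)
    show "Poly_Mapping.lookup m x = 0" if "x \<notin> {..<r}"
      using m that by (auto simp: expts_def in_keys_iff)
  qed
  moreover have "finite ?F" by (rule finite_set_of_finite_funs[OF finite_lessThan finite_atMost])
  moreover have "inj_on Poly_Mapping.lookup (expts r d)"
    by (simp add: inj_on_def)
  ultimately show ?thesis using finite_imageD finite_subset by blast
qed

lemma forms_eq: "forms r d = {p. Poly_Mapping.keys p \<subseteq> expts r d}"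
  by (auto simp: forms_def expts_def mpoly_ring_def)

lemma forms_eq_span: "forms r d = mp.span (mon ` expts r d)"
  by (auto simp: forms_eq in_span_mon_iff)

lemma subspace_forms: "mp.subspace (forms r d)"
  by (simp add: forms_eq_span)

lemma forms_finite_span:
  obtains W :: "'k::field mpoly set" where "finite W" "forms r d \<subseteq> mp.span W"
  using that[of "mon ` expts r d"] finite_expts by (auto simp: forms_eq_span)

lemma dim_forms: "mp.dim (forms r d :: 'k::field mpoly set) = card (expts r d)"
  unfolding forms_eq_span mp.dim_span
  by (simp add: mp.dim_eq_card_independent independent_mon finite_expts card_image inj_mon)

lemma mult_in_forms:
  assumes "p \<in> forms r d" "q \<in> forms r e"
  shows "p * q \<in> forms r (d + e)"
proof -
  have "m \<in> expts r (d + e)" if "m \<in> Poly_Mapping.keys (p * q)" for m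
  proof -
    from that obtain a b where ab: "m = a + b" "a \<in> Poly_Mapping.keys p" "b \<in> Poly_Mapping.keys q"
      using keys_mult[of p q] by blast
    then have "a \<in> expts r d" "b \<in> expts r e" using assms by (auto simp: forms_eq)
    then show ?thesis using keys_add[of a b] by (auto simp: expts_def mdeg_add ab(1))
  qed
  then show ?thesis by (auto simp: forms_eq)
qed

lemma mult_in_forms_Suc:
  "x \<in> forms r 1 \<Longrightarrow> p \<in> forms r d \<Longrightarrow> x * p \<in> forms r (Suc d)"
  using mult_in_forms[of x r 1 p d] by simp

lemma mon_in_forms_iff: "mon m \<in> forms r d \<longleftrightarrow> m \<in> expts r d"
  by (simp add: forms_eq)

lemma expts_Suc_split:
  assumes "m \<in> expts r (Suc d)"
  obtains i n where "i < r" "n \<in> expts r d" "m = Poly_Mapping.single i 1 + n"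
proof -
  have "m \<noteq> 0" using assms by (auto simp: expts_def)
  then obtain i where i: "i \<in> Poly_Mapping.keys m" by (metis keys_eq_empty all_not_in_conv)
  define n where "n = m - Poly_Mapping.single i 1"
  have m: "m = Poly_Mapping.single i 1 + n"
    using i by (intro poly_mapping_eqI)
      (auto simp: n_def lookup_add lookup_minus lookup_single when_def in_keys_iff)
  have "Poly_Mapping.keys n \<subseteq> Poly_Mapping.keys m"
    by (auto simp: n_def in_keys_iff lookup_minus)
  moreover have "mdeg m = 1 + mdeg n"
    using mdeg_add[of "Poly_Mapping.single i 1" n] by (simp only: mdeg_single m[symmetric])
  ultimately have "n \<in> expts r d" "i < r"
    using assms i by (auto simp: expts_def)
  then show thesis using that m by blast
qed

lemma expts_0: "expts r 0 = {0}"
  by (auto simp: expts_def)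

lemma expts_1: "expts r 1 = (\<lambda>i. Poly_Mapping.single i 1) ` {..<r}"
proof -
  have "m \<in> (\<lambda>i. Poly_Mapping.single i 1) ` {..<r}" if m: "m \<in> expts r 1" for m
    using expts_Suc_split[of m r 0] m by (auto simp: expts_0)
  then show ?thesis by (auto simp: expts_def)
qed

lemma card_expts_1: "card (expts r 1) = r"
  unfolding expts_1 by (simp add: card_image inj_single1 del: One_nat_def)

text \<open>A new variable with index \<open>r\<close> contributes its products with the variables
  \<open>0\<close>, ..., \<open>r\<close>, which is \<open>r + 1\<close> new monomials.\<close>

lemma card_expts_2: "(r + 1) choose 2 \<le> card (expts r 2)"
proof (induction r)
  case (Suc r)
  let ?f = "\<lambda>i. Poly_Mapping.single i 1 + Poly_Mapping.single r (1::nat)"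
  have "inj_on ?f {..r}"
    using inj_single1[of "{..r}"] by (simp add: inj_on_def)
  then have "card (?f ` {..r}) = Suc r" by (simp add: card_image)
  moreover have "expts r 2 \<inter> ?f ` {..r} = {}"
  proof -
    have "Poly_Mapping.lookup (?f i) r \<noteq> 0" for i by (simp add: lookup_add)
    moreover have "Poly_Mapping.lookup m r = 0" if "m \<in> expts r 2" for m
      using that by (auto simp: expts_def in_keys_iff)
    ultimately show ?thesis by blast
  qed
  moreover have "expts r 2 \<union> ?f ` {..r} \<subseteq> expts (Suc r) 2"
  proof -
    have "Poly_Mapping.keys (?f i) \<subseteq> {..<Suc r}" if "i \<le> r" for i
      using keys_add[of "Poly_Mapping.single i (1::nat)" "Poly_Mapping.single r 1"] that by auto
    then show ?thesis by (fastforce simp: expts_def mdeg_add)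
  qed
  ultimately have "card (expts r 2) + Suc r \<le> card (expts (Suc r) 2)"
    using card_Un_disjoint[of "expts r 2" "?f ` {..r}"] card_mono[OF finite_expts, of _ "Suc r" 2]
      finite_expts[of r 2] by (metis finite_atMost finite_imageI)
  moreover have "(Suc r + 1) choose 2 = Suc r + ((r + 1) choose 2)"
    by (simp add: numeral_2_eq_2)
  ultimately show ?case using Suc by linarith
qed (simp add: binomial_eq_0)

lemma forms_Suc_subset_span:
  "forms r (Suc d) \<subseteq> mp.span {x * y | x y. x \<in> forms r 1 \<and> y \<in> forms r d}"
  unfolding forms_eq_span[of r "Suc d"]
proof (rule mp.span_mono, rule image_subsetI)
  fix m assume "m \<in> expts r (Suc d)"
  then obtain i n where "i < r" "n \<in> expts r d" "m = Poly_Mapping.single i 1 + n"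
    by (rule expts_Suc_split)
  moreover have "mon m = mon (Poly_Mapping.single i 1) * mon n" if "m = Poly_Mapping.single i 1 + n"
    using that by (simp add: mult_single)
  ultimately show "mon m \<in> {x * y | x y. x \<in> forms r 1 \<and> y \<in> forms r d}"
    by (metis (mono_tags, lifting) mem_Collect_eq mon_in_forms_iff expts_1 imageI lessThan_iff)
qed

text \<open>Evaluation at the 0/1-vector with support \<open>T\<close>.\<close>

definition eval01 :: "nat set \<Rightarrow> 'k::field mpoly \<Rightarrow> 'k"
  where "eval01 T p = (\<Sum>m\<in>Poly_Mapping.keys p. Poly_Mapping.lookup p m when Poly_Mapping.keys m \<subseteq> T)"

lemma eval01_eq_sum:
  assumes "finite M" "Poly_Mapping.keys p \<subseteq> M"
  shows "eval01 T p = (\<Sum>m\<in>M. Poly_Mapping.lookup p m when Poly_Mapping.keys m \<subseteq> T)"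
  unfolding eval01_def using assms by (intro sum.mono_neutral_left) (auto simp: in_keys_iff)

lemma functional_eval01: "mp.functional (eval01 T)"
  unfolding mp.functional_def
proof (intro conjI allI)
  fix p q :: "'a mpoly" and c
  let ?M = "Poly_Mapping.keys p \<union> Poly_Mapping.keys q"
  show "eval01 T (p + q) = eval01 T p + eval01 T q"
    using keys_add[of p q]
    by (simp add: eval01_eq_sum[of ?M] lookup_add when_add_distrib sum.distrib)
  have "Poly_Mapping.keys (pscale c p) \<subseteq> Poly_Mapping.keys p" by (auto simp: in_keys_iff)
  then show "eval01 T (pscale c p) = c * eval01 T p"
    by (simp add: eval01_eq_sum[of "Poly_Mapping.keys p"] sum_distrib_left mult_when)
qed

lemma eval01_mon: "eval01 T (mon m) = (1 when Poly_Mapping.keys m \<subseteq> T)"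
  by (simp add: eval01_def)

lemma keys_plus_nat: "Poly_Mapping.keys (m + n) = Poly_Mapping.keys m \<union> Poly_Mapping.keys n"
  for m n :: "nat \<Rightarrow>\<^sub>0 nat"
  by (auto simp: in_keys_iff lookup_add)

lemma functional_comp_mult: "mp.functional f \<Longrightarrow> mp.functional (\<lambda>p. f (p * q))"
  by (simp add: mp.functional_def distrib_right mult.assoc)

text \<open>Both sides are linear in each factor, so monomials suffice. For these the support of a
  product is the union of the supports, which lies in \<open>T\<close> iff both do.\<close>

lemma eval01_mult: "eval01 T (p * q) = eval01 T p * eval01 T q"
proof -
  have span: "p \<in> mp.span (range mon)" for p :: "'a mpoly" by (simp add: in_span_mon_iff)
  have E: "mp.functional (eval01 T :: 'a mpoly \<Rightarrow> 'a)" by (rule functional_eval01)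
  have mm: "eval01 T (mon m * mon n :: 'a mpoly) = eval01 T (mon m) * eval01 T (mon n)" for m n
    by (auto simp: mult_single eval01_mon keys_plus_nat when_def)
  have *: "eval01 T (mon m * q) - eval01 T q * eval01 T (mon m) = 0" for m
    unfolding mult.commute[of "mon m" q]
    by (rule mp.functional_zero_on_span[OF mp.functional_diff_mult[OF functional_comp_mult[OF E] E] _ span])
      (auto simp: mm)
  have "eval01 T (p * q) - eval01 T p * eval01 T q = 0"
    by (rule mp.functional_zero_on_span[OF mp.functional_diff_mult[OF functional_comp_mult[OF E] E] _ span])
      (use * in \<open>auto simp: mult.commute\<close>)
  then show ?thesis by simp
qed

text \<open>The support of a product of the variables \<open>i\<close> and \<open>j\<close> is
  \<open>{i, j}\<close>, which determines the unordered pair. In degree 3 this breaks down, as two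
  variables admit two monomials with full support.\<close>

lemma expts_2_eq:
  assumes "m \<in> expts r 2" "n \<in> expts r 2" "Poly_Mapping.keys m = Poly_Mapping.keys n"
  shows "m = n"
proof -
  have *: "\<exists>i j. m = Poly_Mapping.single i 1 + Poly_Mapping.single j 1" if "m \<in> expts r 2" for m
  proof -
    from that have "m \<in> expts r (Suc 1)" by (simp add: numeral_2_eq_2)
    then obtain i m' where "m' \<in> expts r 1" "m = Poly_Mapping.single i 1 + m'"
      by (rule expts_Suc_split)
    then show ?thesis unfolding expts_1 by blast
  qed
  obtain i j where m: "m = Poly_Mapping.single i 1 + Poly_Mapping.single j 1"
    using * assms by blast
  obtain k l where n: "n = Poly_Mapping.single k 1 + Poly_Mapping.single l 1"
    using * assms by blast
  have "{i, j} = {k, l}" using assms(3) by (simp add: m n keys_plus_nat insert_commute)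
  then show ?thesis by (auto simp: m n doubleton_eq_iff add.commute)
qed

text \<open>\<open>T\<close> is the support of a monomial \<open>m\<close> of \<open>p\<close> with
  as few variables as possible. Only monomials supported in \<open>T\<close> survive evaluation; by
  minimality and \<open>expts_2_eq\<close> that is \<open>m\<close> alone, so the value is its
  coefficient. Any variable from \<open>T\<close> serves as \<open>x\<close>.\<close>

lemma eval01_nonzero:
  assumes "p \<in> forms r 2" "p \<noteq> 0"
  obtains T x where "x \<in> forms r 1" "eval01 T x \<noteq> 0" "eval01 T p \<noteq> 0"
proof -
  have ne: "Poly_Mapping.keys p \<noteq> {}" using assms by simp
  obtain m where m: "m \<in> Poly_Mapping.keys p"
    and min: "\<And>n. n \<in> Poly_Mapping.keys p \<Longrightarrow> card (Poly_Mapping.keys m) \<le> card (Poly_Mapping.keys n)"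
    using ne ex_has_least_nat[of "\<lambda>m. m \<in> Poly_Mapping.keys p" _ "\<lambda>m. card (Poly_Mapping.keys m)"]
    by (meson all_not_in_conv)
  let ?T = "Poly_Mapping.keys m"
  have mM: "m \<in> expts r 2" and sub: "Poly_Mapping.keys p \<subseteq> expts r 2"
    using assms m by (auto simp: forms_eq)
  have "Poly_Mapping.keys n \<subseteq> ?T \<longleftrightarrow> n = m" if "n \<in> Poly_Mapping.keys p" for n
    using expts_2_eq[of n r m] min[OF that] sub mM that
    by (metis card_seteq finite_keys subset_iff)
  then have "eval01 ?T p = (\<Sum>n\<in>Poly_Mapping.keys p. if n = m then Poly_Mapping.lookup p n else 0)"
    unfolding eval01_def by (intro sum.cong) (auto simp: when_def)
  also have "\<dots> = Poly_Mapping.lookup p m" using m by simp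
  finally have p: "eval01 ?T p \<noteq> 0" using m by (simp add: in_keys_iff)
  have "m \<noteq> 0" using mM by (auto simp: expts_def)
  then obtain i where i: "i \<in> ?T" by (metis keys_eq_empty all_not_in_conv)
  have "mon (Poly_Mapping.single i 1) \<in> forms r 1"
    using i mM by (auto simp: mon_in_forms_iff expts_def)
  moreover have "eval01 ?T (mon (Poly_Mapping.single i 1)) \<noteq> 0"
    using i by (simp add: eval01_mon)
  ultimately show thesis using that p by blast
qed

section \<open>Quadrics and cubics of a level algebra\<close>

text \<open>
  \<open>U2\<close> and \<open>U3\<close> play the roles of \<open>I\<^sub>2\<close> and \<open>I\<^sub>3\<close>. Besides \<open>R\<^sub>1 U2 \<subseteq> U3\<close>, the last two
  conditions say that \<open>R/I\<close> has no socle in degrees 2 and 1.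
\<close>

definition level_pair :: "nat \<Rightarrow> 'k::field mpoly set \<Rightarrow> 'k mpoly set \<Rightarrow> bool"
  where "level_pair r U2 U3 \<longleftrightarrow>
    mp.subspace U2 \<and> mp.subspace U3 \<and> U2 \<subseteq> forms r 2 \<and> U3 \<subseteq> forms r 3 \<and>
    (\<forall>p\<in>forms r 2. p \<in> U2 \<longleftrightarrow> (\<forall>x\<in>forms r 1. x * p \<in> U3)) \<and>
    (\<forall>y\<in>forms r 1. (\<forall>x\<in>forms r 1. x * y \<in> U2) \<longrightarrow> y = 0)"

lemma mult_forms_1_1: "x \<in> forms r 1 \<Longrightarrow> y \<in> forms r 1 \<Longrightarrow> x * y \<in> forms r 2"
  using mult_in_forms[of x r 1 y 1] by (simp add: numeral_2_eq_2)

lemma mult_forms_1_2: "x \<in> forms r 1 \<Longrightarrow> p \<in> forms r 2 \<Longrightarrow> x * p \<in> forms r 3"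
  using mult_in_forms[of x r 1 p 2] by (simp add: numeral_3_eq_3 numeral_2_eq_2)

text \<open>If \<open>x\<close> kills all quadrics, its multiples by linear forms are socle elements
  in degree 2, hence zero; then \<open>x\<close> itself is a socle element in degree 1. The
  refutations below end by contradicting this.\<close>

lemma level_pair_faithful:
  assumes "level_pair r U2 U3" "x \<in> forms r 1" "\<And>p. p \<in> forms r 2 \<Longrightarrow> x * p \<in> U3"
  shows "x = 0"
proof -
  have "y * x \<in> U2" if y: "y \<in> forms r 1" for y
  proof -
    have "z * (y * x) \<in> U3" if "z \<in> forms r 1" for z
      using assms(3)[OF mult_forms_1_1[OF that y]] by (simp add: ac_simps)
    then show ?thesis
      using assms(1) mult_forms_1_1[OF y assms(2)] by (auto simp: level_pair_def)
  qed
  then show ?thesis using assms(1,2) by (simp add: level_pair_def)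
qed

text \<open>
  The situation to be refuted. The functionals \<open>f g\<close> are the coordinates of \<open>R\<^sub>3 / U3\<close> with
  respect to the basis \<open>G\<close>, and \<open>P\<close> picks a witness of \<open>obstructed\<close> for each basis element.
\<close>

locale obstruction =
  fixes r :: nat and U2 U3 G :: "'k::field mpoly set"
    and f :: "'k mpoly \<Rightarrow> 'k mpoly \<Rightarrow> 'k" and P :: "'k mpoly \<Rightarrow> 'k mpoly"
  assumes level: "level_pair r U2 U3"
    and obstructed: "\<And>g. g \<in> forms r 3 \<Longrightarrow> g \<notin> U3 \<Longrightarrow>
      \<exists>p\<in>forms r 2. p \<notin> U2 \<and> (\<forall>x\<in>forms r 1. x * p \<in> mp.span (insert g U3))"
    and G: "G \<subseteq> forms r 3" "finite G"
    and functional_f: "\<And>g. mp.functional (f g)"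
    and dual: "\<And>g h. g \<in> G \<Longrightarrow> h \<in> G \<Longrightarrow> f g h = (if h = g then 1 else 0)"
    and U3_iff: "\<And>p. p \<in> forms r 3 \<Longrightarrow> p \<in> U3 \<longleftrightarrow> (\<forall>g\<in>G. f g p = 0)"
    and P_forms: "\<And>g. g \<in> G \<Longrightarrow> P g \<in> forms r 2"
    and P_notin: "\<And>g. g \<in> G \<Longrightarrow> P g \<notin> U2"
    and P_mult: "\<And>g x. g \<in> G \<Longrightarrow> x \<in> forms r 1 \<Longrightarrow> x * P g \<in> mp.span (insert g U3)"
begin

lemma U2_iff: "p \<in> forms r 2 \<Longrightarrow> p \<in> U2 \<longleftrightarrow> (\<forall>x\<in>forms r 1. x * p \<in> U3)"
  using level by (simp add: level_pair_def)

lemma U3_forms: "p \<in> U3 \<Longrightarrow> p \<in> forms r 3"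
  using level by (auto simp: level_pair_def)

lemma U2_forms: "p \<in> U2 \<Longrightarrow> p \<in> forms r 2"
  using level by (auto simp: level_pair_def)

lemma mult_U3_iff:
  "x \<in> forms r 1 \<Longrightarrow> p \<in> forms r 2 \<Longrightarrow> x * p \<in> U3 \<longleftrightarrow> (\<forall>g\<in>G. f g (x * p) = 0)"
  by (intro U3_iff mult_forms_1_2)

lemma f_U3: "g \<in> G \<Longrightarrow> p \<in> U3 \<Longrightarrow> f g p = 0"
  using U3_iff U3_forms by blast

lemma f_U2: "g \<in> G \<Longrightarrow> x \<in> forms r 1 \<Longrightarrow> p \<in> U2 \<Longrightarrow> f g (x * p) = 0"
  using U2_iff U2_forms f_U3 by blast

lemma off_diagonal:
  assumes "g \<in> G" "h \<in> G" "h \<noteq> g" "x \<in> forms r 1"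
  shows "f h (x * P g) = 0"
  by (rule mp.functional_zero_on_span[OF functional_f _ P_mult[OF assms(1,4)]])
    (use assms dual f_U3 in auto)

text \<open>Modulo \<open>U3\<close>, \<open>x * P g\<close> equals \<open>lam g x\<close> times
  \<open>g\<close>.\<close>

definition lam :: "'k mpoly \<Rightarrow> 'k mpoly \<Rightarrow> 'k"
  where "lam g x = f g (x * P g)"

lemma f_P: "g \<in> G \<Longrightarrow> h \<in> G \<Longrightarrow> x \<in> forms r 1 \<Longrightarrow> f h (x * P g) = (if h = g then lam h x else 0)"
  by (auto simp: lam_def off_diagonal)

lemma functional_lam: "mp.functional (lam g)"
  unfolding lam_def using functional_comp_mult[OF functional_f] .

text \<open>As \<open>P g\<close> lies outside \<open>U2\<close>, some \<open>x * P g\<close> lies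
  outside \<open>U3\<close>, and its only possible nonzero coordinate is the one at
  \<open>g\<close>.\<close>

lemma lam_nonzero:
  assumes "g \<in> G"
  obtains x where "x \<in> forms r 1" "lam g x \<noteq> 0"
  using assms P_notin[OF assms] U2_iff[OF P_forms] mult_U3_iff P_forms f_P by (metis (full_types))

definition W :: "'k mpoly set"
  where "W = mp.span (U2 \<union> P ` G)"

lemma W_forms: "W \<subseteq> forms r 2"
  unfolding W_def using U2_forms P_forms by (intro mp.span_minimal subspace_forms) auto

text \<open>With \<open>y g\<close> chosen so that \<open>lam g (y g)\<close> is nonzero, the
  functionals sending \<open>p\<close> to \<open>f g (y g * p)\<close> vanish on \<open>U2\<close>
  and are dual to the \<open>P g\<close> up to nonzero factors.\<close>

lemma dim_W: "mp.dim W = mp.dim U2 + card G"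
proof -
  obtain B :: "'k mpoly set" where B: "finite B" "forms r 2 \<subseteq> mp.span B"
    by (rule forms_finite_span)
  have "\<forall>g\<in>G. \<exists>x. x \<in> forms r 1 \<and> lam g x \<noteq> 0" using lam_nonzero by metis
  then obtain y where y: "\<And>g. g \<in> G \<Longrightarrow> y g \<in> forms r 1" "\<And>g. g \<in> G \<Longrightarrow> lam g (y g) \<noteq> 0"
    by metis
  have "mp.functional (\<lambda>p. f g (y g * p))" for g
    using functional_comp_mult[OF functional_f, of g "y g"] by (simp add: mult.commute)
  then show ?thesis unfolding W_def
    using B G U2_forms P_forms level f_U2 f_P y
    by (intro mp.dim_span_Un_dual[where W = B and f = "\<lambda>g p. f g (y g * p)"])
      (auto simp: level_pair_def)
qed

lemma dim_W_le: "mp.dim U2 + card G \<le> mp.dim (forms r 2 :: 'k mpoly set)"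
  using forms_finite_span mp.dim_mono_fin[OF W_forms] by (metis dim_W)

text \<open>Multiplication by linear forms is diagonal on \<open>W\<close>: \<open>d g\<close> is
  the coefficient of \<open>P g\<close> in \<open>p\<close> modulo \<open>U2\<close>, and it does
  not depend on \<open>x\<close>.\<close>

lemma W_coordinates:
  assumes "p \<in> W"
  obtains d where "\<And>g x. g \<in> G \<Longrightarrow> x \<in> forms r 1 \<Longrightarrow> f g (x * p) = d g * lam g x"
proof -
  have "\<exists>d. \<forall>g\<in>G. \<forall>x\<in>forms r 1. f g (x * p) = d g * lam g x"
    using assms unfolding W_def
  proof (induction rule: mp.span_induct_alt)
    case base
    show ?case using mp.functional_0[OF functional_f] by (intro exI[of _ "\<lambda>_. 0"]) simp
  next
    case (step c q p)
    from step obtain d where d: "\<forall>g\<in>G. \<forall>x\<in>forms r 1. f g (x * p) = d g * lam g x" by blast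
    obtain e where e: "\<forall>g\<in>G. \<forall>x\<in>forms r 1. f g (x * q) = e g * lam g x"
    proof (cases "q \<in> U2")
      case True
      then show thesis using f_U2 by (intro that[of "\<lambda>_. 0"]) simp
    next
      case False
      then obtain h where "h \<in> G" "q = P h" using step by auto
      then show thesis using f_P by (intro that[of "\<lambda>g. if g = h then 1 else 0"]) simp
    qed
    have "f g (x * (pscale c q + p)) = c * f g (x * q) + f g (x * p)" for g x
      using functional_f[of g] by (simp add: distrib_left mult.left_commute[of x] mp.functional_def)
    then show ?case using d e
      by (intro exI[of _ "\<lambda>g. c * e g + d g"]) (simp add: algebra_simps)
  qed
  then show thesis using that by blast
qed

lemma mult_W:
  assumes "x \<in> forms r 1" "\<And>g. g \<in> G \<Longrightarrow> lam g x = 0" "p \<in> W"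
  shows "x * p \<in> U3"
proof -
  obtain d where "\<And>g. g \<in> G \<Longrightarrow> f g (x * p) = d g * lam g x"
    using W_coordinates[OF assms(3)] assms(1) by metis
  then show ?thesis using assms W_forms by (subst mult_U3_iff) auto
qed

text \<open>
  Applying the obstruction to sums of two basis elements makes all the \<open>lam g\<close> proportional, so
  they have a common zero.
\<close>

lemma not_codim_eq:
  assumes "mp.dim (forms r 2 :: 'k mpoly set) = mp.dim U2 + card G" "2 \<le> r" "G \<noteq> {}"
  shows False
proof -
  obtain B :: "'k mpoly set" where B: "finite B" "forms r 2 \<subseteq> mp.span B"
    by (rule forms_finite_span)
  have W: "W = forms r 2"
    using mp.subspace_dim_eq_fin[OF _ W_forms B(2,1)] assms dim_W by (simp add: W_def)
  obtain g where g: "g \<in> G" using assms by auto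
  have vanish: "lam h x = 0" if h: "h \<in> G" and x: "x \<in> forms r 1" "lam g x = 0" for h x
  proof (cases "h = g")
    case False
    have sum: "g + h \<in> forms r 3" using g h G mp.subspace_add[OF subspace_forms] by blast
    have "f g (g + h) = 1" using g h False dual functional_f[of g] by (simp add: mp.functional_def)
    then have "g + h \<notin> U3" using f_U3[OF g] by force
    then obtain p where p: "p \<in> forms r 2" "p \<notin> U2"
      and pm: "\<And>x. x \<in> forms r 1 \<Longrightarrow> x * p \<in> mp.span (insert (g + h) U3)"
      using obstructed[OF sum] by blast
    obtain d where d: "\<And>j x. j \<in> G \<Longrightarrow> x \<in> forms r 1 \<Longrightarrow> f j (x * p) = d j * lam j x"
      using W_coordinates[of p] p W by blast
    \<comment> \<open>Modulo \<open>U3\<close>, each \<open>y * p\<close> is a multiple of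
      \<open>g + h\<close>: its coordinates at \<open>g\<close> and \<open>h\<close> agree, and
      \<open>other\<close> shows that the remaining ones vanish.\<close>
    have eq: "f g (y * p) - f h (y * p) * 1 = 0" if "y \<in> forms r 1" for y
      by (rule mp.functional_zero_on_span[OF mp.functional_diff_mult[OF functional_f functional_f] _ pm[OF that]])
        (use g h False dual f_U3 functional_f in \<open>auto simp: mp.functional_def\<close>)
    have other: "f j (y * p) = 0" if "y \<in> forms r 1" "j \<in> G" "j \<noteq> g" "j \<noteq> h" for j y
      by (rule mp.functional_zero_on_span[OF functional_f _ pm[OF that(1)]])
        (use g h that dual f_U3 functional_f in \<open>auto simp: mp.functional_def\<close>)
    obtain y j where y: "y \<in> forms r 1" "j \<in> G" "f j (y * p) \<noteq> 0"
      using p U2_iff mult_U3_iff by blast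
    moreover have "f g (y * p) = f h (y * p)" using eq[OF y(1)] by simp
    ultimately have "f h (y * p) \<noteq> 0" using other[OF y(1,2)] by metis
    then have "d h \<noteq> 0" using d[OF h y(1)] by auto
    moreover have "d g * lam g x = d h * lam h x"
      using eq[OF x(1)] d[OF g x(1)] d[OF h x(1)] by simp
    ultimately show ?thesis using x by simp
  qed (use x in simp)
  obtain C :: "'k mpoly set" where C: "finite C" "forms r 1 \<subseteq> mp.span C"
    by (rule forms_finite_span)
  \<comment> \<open>Since \<open>r\<close> is at least 2, the single functional \<open>lam g\<close>
    has a nonzero zero; by \<open>vanish\<close> it is a zero of every \<open>lam h\<close>.\<close>
  have "\<exists>x\<in>forms r 1. x \<noteq> 0 \<and> (\<forall>f\<in>{lam g}. f x = 0)"
    using C assms functional_lam card_expts_1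
    by (intro mp.common_zero[OF _ _ subspace_forms C(2,1)]) (auto simp: dim_forms)
  then obtain x where x: "x \<in> forms r 1" "x \<noteq> 0" "lam g x = 0" by auto
  have "x = 0"
    using mult_W[OF x(1) vanish] x W by (intro level_pair_faithful[OF level x(1)]) auto
  then show False using x by simp
qed

text \<open>
  Here \<open>forms r 2\<close> is spanned by \<open>W\<close> and one more quadric \<open>q\<close>. By the symmetry of the trilinear
  form \<open>f g (x * y * z)\<close>, the functional \<open>beta\<close> lies in the span of \<open>lam g\<close> and \<open>mu g\<close> whenever these
  are independent, so that \<open>beta\<close> and one further functional \<open>psi g\<close> for each \<open>g\<close> suffice to
  control all \<open>lam g\<close> and \<open>mu g\<close>. There are too few of them not to have a common zero.
\<close>

lemma not_codim_Suc:
  assumes "mp.dim (forms r 2 :: 'k mpoly set) = Suc (mp.dim U2 + card G)" "card G + 2 \<le> r"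
  shows False
proof -
  obtain B :: "'k mpoly set" where B: "finite B" "forms r 2 \<subseteq> mp.span B"
    by (rule forms_finite_span)
  have sW: "mp.subspace W" by (simp add: W_def)
  obtain Q b0 where Q: "Q \<subseteq> forms r 2" "finite Q" "mp.dim (forms r 2 :: 'k mpoly set) = mp.dim W + card Q"
    and b0: "\<And>g. mp.functional (b0 g)" "\<And>g h. g \<in> Q \<Longrightarrow> h \<in> Q \<Longrightarrow> b0 g h = (if h = g then 1 else 0)"
      "\<And>p. p \<in> forms r 2 \<Longrightarrow> p \<in> W \<longleftrightarrow> (\<forall>g\<in>Q. b0 g p = 0)"
    by (rule mp.quotient_coordinates[OF sW W_forms subspace_forms B(2,1)]) (rule that; assumption)
  have "card Q = 1" using Q assms dim_W by simp
  then obtain q where q: "Q = {q}" by (auto simp: card_1_singleton_iff)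
  define b where "b = b0 q"
  have b: "mp.functional b" "b q = 1" "\<And>p. p \<in> forms r 2 \<Longrightarrow> p \<in> W \<longleftrightarrow> b p = 0" and qF: "q \<in> forms r 2"
    using b0 Q q by (auto simp: b_def)
  define mu where "mu g x = f g (x * q)" for g x
  have functional_mu: "mp.functional (mu g)" for g
    unfolding mu_def using functional_comp_mult[OF functional_f] .

  \<comment> \<open>Subtracting \<open>b p\<close> times \<open>q\<close> from \<open>p\<close>
    leaves an element of \<open>W\<close>, to which \<open>W_coordinates\<close> applies.\<close>
  have coord: "\<exists>d. \<forall>g\<in>G. \<forall>x\<in>forms r 1. f g (x * p) = d g * lam g x + b p * mu g x"
    if p: "p \<in> forms r 2" for p
  proof -
    let ?w = "p - pscale (b p) q"
    have "b ?w = 0" using b by (simp add: mp.functional_diff mp.functional_def)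
    then have "?w \<in> W"
      using b(3)[of ?w] p qF mp.subspace_diff[OF subspace_forms p mp.subspace_scale[OF subspace_forms qF]]
      by blast
    then obtain d where d: "\<And>g x. g \<in> G \<Longrightarrow> x \<in> forms r 1 \<Longrightarrow> f g (x * ?w) = d g * lam g x"
      using W_coordinates by blast
    have "f g (x * p) = f g (x * ?w) + b p * mu g x" for g x
    proof -
      have "x * p = x * ?w + pscale (b p) (x * q)" by (simp add: algebra_simps)
      then show ?thesis using functional_f[of g] by (simp add: mp.functional_def mu_def)
    qed
    then show ?thesis using d by auto
  qed

  \<comment> \<open>Products of linear forms span the quadrics, so \<open>b\<close> cannot vanish on
    all of them. The resulting \<open>y0\<close> makes \<open>beta\<close> a nonzero
    functional.\<close>
  have "\<exists>x\<in>forms r 1. \<exists>y\<in>forms r 1. b (x * y) \<noteq> 0"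
  proof (rule ccontr)
    assume "\<not> ?thesis"
    then have "b x = 0" if "x \<in> {x * y | x y. x \<in> forms r 1 \<and> y \<in> forms r 1}" for x
      using that by auto
    moreover have "q \<in> mp.span {x * y | x y. x \<in> forms r 1 \<and> y \<in> forms r 1}"
      using forms_Suc_subset_span[of r 1] qF by (auto simp: numeral_2_eq_2)
    ultimately have "b q = 0" using mp.functional_zero_on_span[OF b(1)] by blast
    then show False using b by simp
  qed
  then obtain x0 y0 where x0: "x0 \<in> forms r 1" and y0: "y0 \<in> forms r 1" and x0y0: "b (x0 * y0) \<noteq> 0"
    by blast
  define beta where "beta x = b (x * y0)" for x
  have functional_beta: "mp.functional beta"
    unfolding beta_def using functional_comp_mult[OF b(1)] .

  have "\<exists>psi. mp.functional psi \<and>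
      (\<forall>x\<in>forms r 1. beta x = 0 \<longrightarrow> psi x = 0 \<longrightarrow> lam g x = 0 \<and> mu g x = 0)" if g: "g \<in> G" for g
  proof (cases "\<forall>x\<in>forms r 1. lam g x = 0 \<longrightarrow> mu g x = 0")
    case True
    then show ?thesis using functional_lam by blast
  next
    case False
    then obtain z where z: "z \<in> forms r 1" "lam g z = 0" "mu g z \<noteq> 0" by blast
    obtain D E where DE: "\<And>x. x \<in> forms r 1 \<Longrightarrow> f g (x * (y0 * z)) = D * lam g x + E * mu g x"
      using coord[OF mult_forms_1_1[OF y0 z(1)]] g by blast
    \<comment> \<open>The cubic \<open>x * y0 * z\<close> is expanded in two ways. As
      \<open>z\<close> times \<open>x * y0\<close> its \<open>lam\<close> term drops out because
      \<open>lam g z = 0\<close>; as \<open>x\<close> times \<open>y0 * z\<close> it gives a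
      combination of \<open>lam g x\<close> and \<open>mu g x\<close>.\<close>
    have key: "beta x * mu g z = D * lam g x + E * mu g x" if x: "x \<in> forms r 1" for x
    proof -
      have "f g (z * (x * y0)) = beta x * mu g z"
        using coord[OF mult_forms_1_1[OF x y0]] g z by (auto simp: beta_def)
      moreover have "z * (x * y0) = x * (y0 * z)" by (simp add: ac_simps)
      ultimately show ?thesis using DE[OF x] by simp
    qed
    show ?thesis
    \<comment> \<open>On zeros of \<open>beta\<close>, \<open>key\<close> is a nontrivial relation
      between \<open>lam g\<close> and \<open>mu g\<close>. If \<open>E = 0\<close>, it forces
      \<open>lam g\<close> to vanish and \<open>mu g\<close> remains as \<open>psi\<close>;
      otherwise \<open>lam g\<close> determines \<open>mu g\<close> and serves as
      \<open>psi\<close>.\<close>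
    proof (cases "E = 0")
      case True
      then have "D \<noteq> 0" using key[OF x0] x0y0 z by (auto simp: beta_def)
      then have "\<forall>x\<in>forms r 1. beta x = 0 \<longrightarrow> mu g x = 0 \<longrightarrow> lam g x = 0 \<and> mu g x = 0"
        using key True by force
      then show ?thesis using functional_mu by blast
    next
      case False
      then have "\<forall>x\<in>forms r 1. beta x = 0 \<longrightarrow> lam g x = 0 \<longrightarrow> lam g x = 0 \<and> mu g x = 0"
        using key by force
      then show ?thesis using functional_lam by blast
    qed
  qed
  then obtain psi where psi: "\<And>g. g \<in> G \<Longrightarrow> mp.functional (psi g)"
    "\<And>g x. g \<in> G \<Longrightarrow> x \<in> forms r 1 \<Longrightarrow> beta x = 0 \<Longrightarrow> psi g x = 0 \<Longrightarrow> lam g x = 0 \<and> mu g x = 0"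
    by metis
  obtain C :: "'k mpoly set" where C: "finite C" "forms r 1 \<subseteq> mp.span C"
    by (rule forms_finite_span)
  \<comment> \<open>At most \<open>t + 1\<close> conditions are imposed on a space of dimension
    \<open>r\<close>, which is at least \<open>t + 2\<close>.\<close>
  have "card (insert beta (psi ` G)) \<le> Suc (card G)"
    using card_image_le[OF G(2), of psi] G(2) by (auto simp: card_insert_if)
  then have "\<exists>x\<in>forms r 1. x \<noteq> 0 \<and> (\<forall>f\<in>insert beta (psi ` G). f x = 0)"
    using G assms functional_beta psi card_expts_1
    by (intro mp.common_zero[OF _ _ subspace_forms C(2,1)]) (auto simp: dim_forms)
  then obtain x where x: "x \<in> forms r 1" "x \<noteq> 0" "beta x = 0" "\<And>g. g \<in> G \<Longrightarrow> psi g x = 0" by auto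
  have "x * p \<in> U3" if p: "p \<in> forms r 2" for p
    using coord[OF p] psi(2)[OF _ x(1,3,4)] x(1) p by (subst mult_U3_iff) auto
  then have "x = 0" by (rule level_pair_faithful[OF level x(1)])
  then show False using x by simp
qed

end

text \<open>
  Dually, the cubics of the inverse system contain a hyperplane, the annihilator of \<open>g\<close>, with the
  same space of first derivatives.
\<close>

lemma exists_free_cubic:
  fixes U2 U3 :: "'k::field mpoly set"
  assumes level: "level_pair r U2 U3"
    and dims: "mp.dim (forms r 2 :: 'k mpoly set) = mp.dim U2 + a"
      "mp.dim (forms r 3 :: 'k mpoly set) = mp.dim U3 + t"
    and t: "0 < t" "a < t \<or> a = t \<and> 2 \<le> r \<or> a = Suc t \<and> t + 2 \<le> r"
  obtains g where "g \<in> forms r 3" "g \<notin> U3"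
    "\<forall>p\<in>forms r 2. (\<forall>x\<in>forms r 1. x * p \<in> mp.span (insert g U3)) \<longrightarrow> p \<in> U2"
proof (rule ccontr)
  note cubicI = that
  assume "\<not> thesis"
  then have ob: "\<exists>p\<in>forms r 2. p \<notin> U2 \<and> (\<forall>x\<in>forms r 1. x * p \<in> mp.span (insert g U3))"
    if "g \<in> forms r 3" "g \<notin> U3" for g
    using that cubicI[OF that] by blast
  obtain B :: "'k mpoly set" where B: "finite B" "forms r 3 \<subseteq> mp.span B"
    by (rule forms_finite_span)
  have sub: "mp.subspace U3" "U3 \<subseteq> forms r 3" using level by (auto simp: level_pair_def)
  obtain G f where G: "G \<subseteq> forms r 3" "finite G" "mp.dim (forms r 3 :: 'k mpoly set) = mp.dim U3 + card G"
    and f: "\<And>g. mp.functional (f g)" "\<And>g h. g \<in> G \<Longrightarrow> h \<in> G \<Longrightarrow> f g h = (if h = g then 1 else 0)"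
      "\<And>p. p \<in> forms r 3 \<Longrightarrow> p \<in> U3 \<longleftrightarrow> (\<forall>g\<in>G. f g p = 0)"
    by (rule mp.quotient_coordinates[OF sub subspace_forms B(2,1)]) (rule that; assumption)
  have "\<forall>g\<in>G. g \<notin> U3" using f G by (metis subsetD one_neq_zero)
  then have "\<forall>g\<in>G. \<exists>p\<in>forms r 2. p \<notin> U2 \<and> (\<forall>x\<in>forms r 1. x * p \<in> mp.span (insert g U3))"
    using ob G by blast
  then obtain P where P: "\<And>g. g \<in> G \<Longrightarrow> P g \<in> forms r 2" "\<And>g. g \<in> G \<Longrightarrow> P g \<notin> U2"
      "\<And>g x. g \<in> G \<Longrightarrow> x \<in> forms r 1 \<Longrightarrow> x * P g \<in> mp.span (insert g U3)"
    by metis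
  have cG: "card G = t" using G dims by simp
  interpret obstruction r U2 U3 G f P
    by (rule obstruction.intro[OF level ob G(1,2) f P])
  \<comment> \<open>The \<open>P g\<close> are independent modulo \<open>U2\<close>, which excludes
    the case \<open>a < t\<close>.\<close>
  have "t \<le> a" using dim_W_le dims(1) cG by linarith
  with t consider "a = t" "2 \<le> r" | "a = Suc t" "t + 2 \<le> r" by linarith
  then show False
  proof cases
    case 1
    have "G \<noteq> {}" using t(1) cG by auto
    then show False using not_codim_eq dims(1) cG 1 by simp
  next
    case 2
    then show False using not_codim_Suc dims(1) cG by simp
  qed
qed

text \<open>Hides the 0/1-vector behind the properties that the next construction uses;
  \<open>x\<close> witnesses that the point is not the origin.\<close>

lemma exists_multiplicative_functional:
  fixes p :: "'k::field mpoly"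
  assumes "p \<in> forms r 2" "p \<noteq> 0"
  obtains e :: "'k mpoly \<Rightarrow> 'k" and x where "mp.functional e" "\<And>p q. e (p * q) = e p * e q"
    "x \<in> forms r 1" "e x \<noteq> 0" "e p \<noteq> 0"
  using eval01_nonzero[OF assms] functional_eval01 eval01_mult by metis

text \<open>
  Dually, the hyperplane of cubics annihilated by \<open>g\<close> is completed by the cube of a linear form
  whose square is not among its first derivatives; \<open>e\<close> is evaluation at its coefficient vector.
\<close>

lemma level_pair_step:
  fixes U2 U3 :: "'k::field mpoly set"
  assumes level: "level_pair r U2 U3" and "U2 \<noteq> {0}"
    and dims: "mp.dim (forms r 2 :: 'k mpoly set) = mp.dim U2 + a"
      "mp.dim (forms r 3 :: 'k mpoly set) = mp.dim U3 + t"
    and t: "0 < t" "a < t \<or> a = t \<and> 2 \<le> r \<or> a = Suc t \<and> t + 2 \<le> r"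
  obtains V2 V3 :: "'k mpoly set" where "level_pair r V2 V3"
    "mp.dim (forms r 2 :: 'k mpoly set) = mp.dim V2 + Suc a"
    "mp.dim (forms r 3 :: 'k mpoly set) = mp.dim V3 + t"
proof -
  have sub: "mp.subspace U2" "mp.subspace U3" and incl: "U2 \<subseteq> forms r 2" "U3 \<subseteq> forms r 3"
    and U2_iff: "\<And>p. p \<in> forms r 2 \<Longrightarrow> p \<in> U2 \<longleftrightarrow> (\<forall>x\<in>forms r 1. x * p \<in> U3)"
    and faithful: "\<And>y. y \<in> forms r 1 \<Longrightarrow> (\<And>x. x \<in> forms r 1 \<Longrightarrow> x * y \<in> U2) \<Longrightarrow> y = 0"
    using level by (auto simp: level_pair_def)
  obtain g where g: "g \<in> forms r 3" "g \<notin> U3" and free: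
    "\<forall>p\<in>forms r 2. (\<forall>x\<in>forms r 1. x * p \<in> mp.span (insert g U3)) \<longrightarrow> p \<in> U2"
    by (rule exists_free_cubic[OF level dims t])
  obtain p0 where p0: "p0 \<in> U2" "p0 \<noteq> 0"
    using \<open>U2 \<noteq> {0}\<close> mp.subspace_0[OF sub(1)] by blast
  then have "p0 \<in> forms r 2" using incl by blast
  then obtain e x0 where e: "mp.functional e" "\<And>p q. e (p * q) = e p * e q"
    and x0: "x0 \<in> forms r 1" "e x0 \<noteq> 0" "e p0 \<noteq> 0"
    using exists_multiplicative_functional p0(2) by blast
  define J where "J = mp.span (insert g U3)"
  define V2 where "V2 = {p \<in> U2. e p = 0}"
  define V3 where "V3 = {p \<in> J. e p = 0}"
  have U3J: "U3 \<subseteq> J" unfolding J_def by (auto intro: mp.span_base)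
  have J: "mp.subspace J" "J \<subseteq> forms r 3"
    unfolding J_def using g incl mp.span_minimal[OF _ subspace_forms, of "insert g U3" r 3] by auto
  obtain B2 :: "'k mpoly set" where B2: "finite B2" "forms r 2 \<subseteq> mp.span B2"
    by (rule forms_finite_span)
  obtain B3 :: "'k mpoly set" where B3: "finite B3" "forms r 3 \<subseteq> mp.span B3"
    by (rule forms_finite_span)
  \<comment> \<open>In degree 3 the dimension gained from \<open>g\<close> is lost again to the
    condition \<open>e = 0\<close>; in degree 2 there is only the loss, which is the increase of
    \<open>a\<close>.\<close>
  have "mp.dim J = Suc (mp.dim U3)"
    unfolding J_def using B3 incl g sub by (intro mp.dim_insert_notin[where W = B3]) auto
  moreover have "mp.dim J = Suc (mp.dim V3)"
    unfolding V3_def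
  proof (rule mp.dim_ker[OF J(1) _ B3(1) e(1)])
    \<comment> \<open>By multiplicativity the quadric \<open>p0\<close> also provides a cubic on
      which \<open>e\<close> is nonzero.\<close>
    show "x0 * p0 \<in> J" using p0 x0 incl U2_iff U3J by blast
    show "e (x0 * p0) \<noteq> 0" using x0 by (simp add: e(2))
  qed (use J B3 in auto)
  moreover have "mp.dim U2 = Suc (mp.dim V2)"
    unfolding V2_def using incl B2 by (intro mp.dim_ker[OF sub(1) _ B2(1) e(1) p0(1) x0(3)]) auto
  moreover have "level_pair r V2 V3"
    unfolding level_pair_def
  proof (intro conjI ballI impI)
    show "mp.subspace V2" "mp.subspace V3"
      unfolding V2_def V3_def using sub J e by (auto intro: mp.subspace_ker)
    show "V2 \<subseteq> forms r 2" "V3 \<subseteq> forms r 3"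
      unfolding V2_def V3_def using incl J by auto
    fix p :: "'k mpoly" assume p: "p \<in> forms r 2"
    show "p \<in> V2 \<longleftrightarrow> (\<forall>x\<in>forms r 1. x * p \<in> V3)"
    proof
      assume "p \<in> V2"
      then show "\<forall>x\<in>forms r 1. x * p \<in> V3"
        using U2_iff[OF p] U3J by (auto simp: V2_def V3_def e(2))
    next
      assume *: "\<forall>x\<in>forms r 1. x * p \<in> V3"
      \<comment> \<open>\<open>free\<close> prevents the enlarged \<open>J\<close> from adding socle
        in degree 2; the factor \<open>x0\<close>, nonzero under \<open>e\<close>, then transfers
        the vanishing of \<open>x0 * p\<close> to \<open>p\<close>.\<close>
      then have "p \<in> U2" using free p by (auto simp: V3_def J_def)
      moreover have "e (x0 * p) = 0" using * x0 by (auto simp: V3_def)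
      ultimately show "p \<in> V2" using x0 by (simp add: V2_def e(2))
    qed
  next
    fix y :: "'k mpoly" assume "y \<in> forms r 1" "\<forall>x\<in>forms r 1. x * y \<in> V2"
    then show "y = 0" using faithful by (auto simp: V2_def)
  qed
  ultimately show thesis using dims by (intro that[of V2 V3]) auto
qed

section \<open>Dimensions in quotients of the polynomial ring\<close>

text \<open>Ideals are subspaces. Past an index \<open>N\<close> where the dimension in the chain is
  least, each ideal lies in \<open>J N\<close> and has the same dimension.\<close>

lemma (in ring) finite_dimension_imp_artinian:
  assumes K: "subfield K R" and fin: "finite_dimension K (carrier R)"
  shows "artinian R"
  unfolding artinian_def
proof (intro conjI allI impI)
  show "ring R" by (rule ring_axioms)
  fix J :: "nat \<Rightarrow> 'a set"
  assume "(\<forall>n. ideal (J n) R) \<and> (\<forall>n. J (Suc n) \<subseteq> J n)"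
  then have J: "\<And>n. ideal (J n) R" "\<And>n. J (Suc n) \<subseteq> J n" by auto
  have "\<exists>d. dimension d K (J n)" for n
  proof -
    have "subalgebra K (J n) R" by (rule ideal_is_subalgebra[OF subfieldE(3)[OF K] J(1)])
    moreover have "J n \<subseteq> carrier R"
      using ideal.axioms(1)[OF J(1)] by (rule additive_subgroup.a_subset)
    ultimately show ?thesis
      using subalbegra_incl_imp_finite_dimension[OF K fin] finite_dimension_def by blast
  qed
  then obtain d where d: "\<And>n. dimension (d n) K (J n)" by metis
  obtain N where N: "\<And>n. d N \<le> d n"
    using ex_has_least_nat[of "\<lambda>_. True" _ d] by blast
  have "J n = J N" if "N \<le> n" for n
  proof -
    have sub: "J n \<subseteq> J N" using lift_Suc_antimono_le[of J] J(2) that by blast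
    obtain Us where Us: "set Us \<subseteq> carrier R" "independent K Us" "length Us = d n" "Span K Us = J n"
      using exists_base[OF K d] by blast
    then have "set Us \<subseteq> J N" using Span_base_incl[OF K] sub by blast
    then have "length Us = d N"
      using independent_length_le_dimension[OF K d Us(2)] N[of n] Us(3) by force
    then show ?thesis
      using independent_length_eq_dimension[OF K d Us(2) \<open>set Us \<subseteq> J N\<close>] Us(4) by simp
  qed
  then show "\<exists>N. \<forall>n\<ge>N. J n = J N" by blast
qed

section \<open>The polynomial ring over its constants, and its quotients\<close>

lemma mpoly_ring_simps [simp]:
  "x \<otimes>\<^bsub>mpoly_ring r\<^esub> y = x * y" "x \<oplus>\<^bsub>mpoly_ring r\<^esub> y = x + y"
  "\<one>\<^bsub>mpoly_ring r\<^esub> = 1" "\<zero>\<^bsub>mpoly_ring r\<^esub> = 0"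
  by (auto simp: mpoly_ring_def)

lemma carrier_eq: "carrier (mpoly_ring r) = {p. Poly_Mapping.keys p \<subseteq> {m. Poly_Mapping.keys m \<subseteq> {..<r}}}"
  by (simp add: mpoly_ring_def subset_iff Ball_def)

lemma carrier_eq_span: "carrier (mpoly_ring r) = mp.span (mon ` {m. Poly_Mapping.keys m \<subseteq> {..<r}})"
  by (simp add: carrier_eq set_eq_iff in_span_mon_iff)

lemma subspace_carrier: "mp.subspace (carrier (mpoly_ring r))"
  by (simp add: carrier_eq_span)

lemma forms_carrier: "forms r d \<subseteq> carrier (mpoly_ring r)"
  by (auto simp: forms_def)

lemma const_carrier: "Poly_Mapping.single 0 c \<in> carrier (mpoly_ring r)"
  by (auto simp: carrier_eq)

interpretation mr: cring "mpoly_ring r :: 'k::field mpoly ring" for r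
  by (rule cring_mpoly_ring)

lemma mpoly_ring_uminus: "p \<in> carrier (mpoly_ring r) \<Longrightarrow> \<ominus>\<^bsub>mpoly_ring r\<^esub> p = - p"
  by (rule mr.minus_equality) (simp_all add: mp.subspace_neg[OF subspace_carrier])

lemma mpoly_ring_minus:
  "p \<in> carrier (mpoly_ring r) \<Longrightarrow> q \<in> carrier (mpoly_ring r) \<Longrightarrow> p \<ominus>\<^bsub>mpoly_ring r\<^esub> q = p - q"
  by (simp add: a_minus_def mpoly_ring_uminus)

lemma ideal_subspace:
  assumes "ideal I (mpoly_ring r)"
  shows "mp.subspace I"
proof -
  interpret ideal I "mpoly_ring r" by fact
  show ?thesis
    using zero_closed a_closed I_l_closed[OF _ const_carrier]
    by (auto simp: mp.subspace_def)
qed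

abbreviation consts_field :: "'k::field mpoly set"
  where "consts_field \<equiv> range (Poly_Mapping.single 0)"

lemma subfield_consts: "subfield (consts_field :: 'k::field mpoly set) (mpoly_ring r)"
proof (rule mr.subfieldI)
  let ?K = "consts_field :: 'k mpoly set"
  show "subcring ?K (mpoly_ring r)"
  proof (rule mr.subcringI', rule mr.subringI)
    show "?K \<subseteq> carrier (mpoly_ring r)" using const_carrier by auto
    show "\<one>\<^bsub>mpoly_ring r\<^esub> \<in> ?K" using single_one by (metis mpoly_ring_simps(3) rangeI)
    fix h h' :: "'k mpoly" assume "h \<in> ?K"
    then obtain c where h: "h = Poly_Mapping.single 0 c" by auto
    show "\<ominus>\<^bsub>mpoly_ring r\<^esub> h \<in> ?K"
      unfolding h mpoly_ring_uminus[OF const_carrier] single_uminus[symmetric] by (rule rangeI)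
    assume "h' \<in> ?K"
    then obtain c' where h': "h' = Poly_Mapping.single 0 c'" by auto
    show "h \<otimes>\<^bsub>mpoly_ring r\<^esub> h' \<in> ?K" by (simp add: h h' mult_single)
    show "h \<oplus>\<^bsub>mpoly_ring r\<^esub> h' \<in> ?K" by (simp add: h h' flip: single_add)
  qed
  show "Units (mpoly_ring r\<lparr>carrier := ?K\<rparr>) = ?K - {\<zero>\<^bsub>mpoly_ring r\<^esub>}"
  proof (intro equalityI subsetI)
    fix h assume h: "h \<in> ?K - {\<zero>\<^bsub>mpoly_ring r\<^esub>}"
    then obtain c where c: "h = Poly_Mapping.single 0 c" by auto
    with h have "c \<noteq> 0" by auto
    have "Poly_Mapping.single 0 (inverse c) * h = 1" "h * Poly_Mapping.single 0 (inverse c) = 1"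
      using \<open>c \<noteq> 0\<close> by (simp_all add: c mult_single)
    then show "h \<in> Units (mpoly_ring r\<lparr>carrier := ?K\<rparr>)"
      using h by (auto simp: Units_def)
  qed (auto simp: Units_def)
qed

text \<open>Bridge between \<open>mp.dim\<close> and the inductive \<open>dimension\<close> of the
  algebra library: adjoining a basis vector on one side is a \<open>line_extension\<close> on the
  other.\<close>

lemma dimension_span:
  assumes "finite B" "mp.independent B" "B \<subseteq> carrier (mpoly_ring r)"
  shows "ring.dimension (mpoly_ring r) (card B) consts_field (mp.span B)"
  using assms
proof (induction rule: finite_induct)
  case empty
  then show ?case using mr.zero_dim by simp
next
  case (insert b B)
  have "mr.line_extension r consts_field b (mp.span B) = mp.span (insert b B)"
  proof (intro equalityI subsetI)
    fix u assume "u \<in> mr.line_extension r consts_field b (mp.span B)"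
    then obtain c v where "v \<in> mp.span B" "u = pscale c b + v"
      by (auto simp: mr.line_extension_mem_iff)
    then show "u \<in> mp.span (insert b B)"
      by (auto simp: mp.span_insert intro!: exI[of _ c])
  next
    fix u assume "u \<in> mp.span (insert b B)"
    then obtain c where c: "u - pscale c b \<in> mp.span B" by (auto simp: mp.span_insert)
    have "u = pscale c b + (u - pscale c b)" by simp
    then show "u \<in> mr.line_extension r consts_field b (mp.span B)"
      unfolding mr.line_extension_mem_iff mpoly_ring_simps using c by blast
  qed
  moreover have "b \<notin> mp.span B" "mp.independent B"
    using insert by (auto simp: mp.independent_insert)
  with insert have "mr.dimension r (Suc (card B)) consts_field (mr.line_extension r consts_field b (mp.span B))"
    by (intro mr.Suc_dim) auto
  ultimately show ?case using insert.hyps by simp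
qed

lemma dimension_subspace:
  assumes "mp.subspace S" "S \<subseteq> mp.span W" "finite W" "S \<subseteq> carrier (mpoly_ring r)"
  shows "ring.dimension (mpoly_ring r) (mp.dim S) consts_field S"
proof -
  obtain B where B: "B \<subseteq> S" "mp.independent B" "S \<subseteq> mp.span B" "finite B" "card B = mp.dim S"
    using mp.finite_basis[OF assms(2,3)] by metis
  have "mp.span B = S" using B assms(1) mp.span_minimal by blast
  then show ?thesis using dimension_span[of B r] B assms(4) by auto
qed

locale proper_ideal =
  fixes r :: nat and I :: "'k::field mpoly set"
  assumes ideal_I: "ideal I (mpoly_ring r)" and proper: "I \<noteq> carrier (mpoly_ring r)"
begin

lemma hom_residue: "ring_hom_ring (mpoly_ring r) (quot_alg r I) (residue_class r I)"
  unfolding quot_alg_def residue_class_def[abs_def]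
  using ideal.rcos_ring_hom_ring[OF ideal_I] .

sublocale res: ring_hom_ring "mpoly_ring r" "quot_alg r I" "residue_class r I"
  by (rule hom_residue)

lemma subspace_I: "mp.subspace I"
  by (rule ideal_subspace[OF ideal_I])

lemma I_carrier: "I \<subseteq> carrier (mpoly_ring r)"
  using ideal.axioms(1)[OF ideal_I] by (rule additive_subgroup.a_subset)

lemma mult_I: "p \<in> I \<Longrightarrow> q \<in> carrier (mpoly_ring r) \<Longrightarrow> q * p \<in> I"
  using ideal.I_l_closed[OF ideal_I] by simp

lemma residue_eq_iff:
  "p \<in> carrier (mpoly_ring r) \<Longrightarrow> q \<in> carrier (mpoly_ring r) \<Longrightarrow>
    residue_class r I p = residue_class r I q \<longleftrightarrow> p - q \<in> I"
  using mr.quotient_eq_iff_same_a_r_cos[OF ideal_I] mpoly_ring_minus by (metis residue_class_def)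

lemma residue_eq_zero_iff:
  "p \<in> carrier (mpoly_ring r) \<Longrightarrow> residue_class r I p = \<zero>\<^bsub>quot_alg r I\<^esub> \<longleftrightarrow> p \<in> I"
  using residue_eq_iff[of p 0] res.hom_zero mr.zero_closed[of r] by simp

lemma carrier_quot: "carrier (quot_alg r I) = residue_class r I ` carrier (mpoly_ring r)"
  by (auto simp: quot_alg_def FactRing_def A_RCOSETS_def' residue_class_def)

lemma one_notin: "1 \<notin> I"
  using ideal.one_imp_carrier[OF ideal_I] proper by auto

lemma one_quot_neq_zero: "\<one>\<^bsub>quot_alg r I\<^esub> \<noteq> \<zero>\<^bsub>quot_alg r I\<^esub>"
  using residue_eq_zero_iff[of 1] res.hom_one mr.one_closed[of r] one_notin by simp

lemma subfield_base: "subfield (base_field r I) (quot_alg r I)"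
  unfolding base_field_def
  by (rule res.img_is_subfield(2)[OF subfield_consts one_quot_neq_zero])

text \<open>Rank-nullity for the residue map restricted to \<open>F\<close>, whose kernel is
  \<open>I \<inter> F\<close>.\<close>

lemma dimension_image:
  assumes "mp.subspace F" "F \<subseteq> mp.span W" "finite W" "F \<subseteq> carrier (mpoly_ring r)"
  shows "ring.dimension (quot_alg r I) (mp.dim F - mp.dim (I \<inter> F)) (base_field r I) (residue_class r I ` F)"
proof -
  let ?ker = "a_kernel (mpoly_ring r\<lparr>carrier := F\<rparr>) (quot_alg r I) (residue_class r I)"
  have "p \<in> ?ker \<longleftrightarrow> p \<in> I \<inter> F" for p
  proof -
    have F: "carrier (mpoly_ring r\<lparr>carrier := F\<rparr>) = F" by simp
    have "p \<in> ?ker \<longleftrightarrow> p \<in> F \<and> residue_class r I p = \<zero>\<^bsub>quot_alg r I\<^esub>"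
      unfolding a_kernel_def' mem_Collect_eq F by (rule refl)
    then show ?thesis using residue_eq_zero_iff[of p] assms(4) by blast
  qed
  then have ker: "?ker = I \<inter> F" by blast
  have "I \<inter> F \<subseteq> mp.span W" "I \<inter> F \<subseteq> carrier (mpoly_ring r)" using assms(2,4) by blast+
  then have "ring.dimension (mpoly_ring r) (mp.dim (I \<inter> F)) consts_field ?ker"
    unfolding ker by (intro dimension_subspace[OF mp.subspace_inter[OF subspace_I assms(1)] _ assms(3)])
  then show ?thesis
    unfolding base_field_def
    by (rule res.rank_nullity_theorem[OF subfield_consts one_quot_neq_zero dimension_subspace[OF assms]])
qed

lemma hilb_eq: "hilb r I d = mp.dim (forms r d :: 'k mpoly set) - mp.dim (I \<inter> forms r d)"
proof -
  obtain B :: "'k mpoly set" where B: "finite B" "forms r d \<subseteq> mp.span B"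
    by (rule forms_finite_span)
  have "ring.dimension (quot_alg r I) (mp.dim (forms r d :: 'k mpoly set) - mp.dim (I \<inter> forms r d))
      (base_field r I) (graded_piece r I d)"
    unfolding graded_piece_def by (rule dimension_image[OF subspace_forms B(2,1) forms_carrier])
  then show ?thesis
    using res.S.dimI[OF subfield_base] by (simp add: hilb_def kdim_def over_def)
qed

lemma socle_iff:
  assumes "p \<in> carrier (mpoly_ring r)"
  shows "residue_class r I p \<in> socle r I \<longleftrightarrow>
    (\<forall>m\<in>carrier (mpoly_ring r). Poly_Mapping.lookup m 0 = 0 \<longrightarrow> m * p \<in> I)"
proof -
  have "residue_class r I p \<otimes>\<^bsub>quot_alg r I\<^esub> residue_class r I m = \<zero>\<^bsub>quot_alg r I\<^esub> \<longleftrightarrow> m * p \<in> I"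
    if "m \<in> carrier (mpoly_ring r)" for m
    using res.hom_mult[OF assms that] residue_eq_zero_iff[of "p * m"] mr.m_closed[OF assms that]
    by (simp add: mult.commute)
  then show ?thesis
    using assms unfolding socle_def hom_max_ideal_def carrier_quot by auto
qed

end

section \<open>Level algebras and level pairs\<close>

lemma lookup_hom_component:
  "Poly_Mapping.lookup (hom_component d p) m = (Poly_Mapping.lookup p m when mdeg m = d)"
  by (auto simp: hom_component_def lookup_mapp when_def in_keys_iff)

lemma hom_component_add: "hom_component d (p + q) = hom_component d p + hom_component d q"
  by (rule poly_mapping_eqI) (simp add: lookup_hom_component lookup_add when_add_distrib)

lemma hom_component_scale: "hom_component d (pscale c p) = pscale c (hom_component d p)"
  by (rule poly_mapping_eqI) (simp add: lookup_hom_component mult_when)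

lemma hom_component_0 [simp]: "hom_component d 0 = 0"
  by (rule poly_mapping_eqI) (simp add: lookup_hom_component)

lemma hom_component_diff: "hom_component d (p - q) = hom_component d p - hom_component d q"
  by (rule poly_mapping_eqI) (simp add: lookup_hom_component lookup_minus when_def)

lemma hom_component_sum: "hom_component d (\<Sum>i\<in>A. f i) = (\<Sum>i\<in>A. hom_component d (f i))"
  by (induction A rule: infinite_finite_induct) (simp_all add: hom_component_add)

lemma keys_hom_component:
  "Poly_Mapping.keys (hom_component d p) = {m \<in> Poly_Mapping.keys p. mdeg m = d}"
  by (auto simp: in_keys_iff lookup_hom_component when_def split: if_splits)

lemma hom_component_forms: "p \<in> carrier (mpoly_ring r) \<Longrightarrow> hom_component d p \<in> forms r d"
  by (auto simp: forms_def mpoly_ring_def keys_hom_component)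

lemma hom_component_of_form:
  assumes "p \<in> forms r d"
  shows "hom_component e p = (if e = d then p else 0)"
proof (rule poly_mapping_eqI)
  fix m
  have "Poly_Mapping.lookup p m = 0" if "mdeg m \<noteq> d"
    using assms that by (auto simp: forms_def in_keys_iff)
  then show "Poly_Mapping.lookup (hom_component e p) m = Poly_Mapping.lookup (if e = d then p else 0) m"
    by (auto simp: lookup_hom_component when_def)
qed

lemma sum_hom_components:
  "p = (\<Sum>d\<in>mdeg ` Poly_Mapping.keys p. hom_component d p)" (is "p = ?s")
proof (rule poly_mapping_eqI)
  fix m
  have "Poly_Mapping.lookup ?s m
      = (\<Sum>d\<in>mdeg ` Poly_Mapping.keys p. if d = mdeg m then Poly_Mapping.lookup p m else 0)"
    unfolding lookup_sum by (intro sum.cong) (auto simp: lookup_hom_component when_def)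
  also have "\<dots> = Poly_Mapping.lookup p m" by (auto simp: in_keys_iff)
  finally show "Poly_Mapping.lookup p m = Poly_Mapping.lookup ?s m" by (rule sym)
qed

lemma subspace_of_components:
  assumes "mp.subspace S" "\<And>d. hom_component d p \<in> S"
  shows "p \<in> S"
  using mp.subspace_sum[OF assms(1), of "mdeg ` Poly_Mapping.keys p" "\<lambda>d. hom_component d p"] assms(2)
  by (simp flip: sum_hom_components)

lemma hom_component_mult:
  assumes "x \<in> forms r 1" "p \<in> carrier (mpoly_ring r)"
  shows "hom_component (Suc d) (x * p) = x * hom_component d p"
proof -
  let ?D = "mdeg ` Poly_Mapping.keys p"
  have "hom_component (Suc d) (x * hom_component e p) = (if e = d then x * hom_component d p else 0)" for e
    using hom_component_of_form[OF mult_in_forms_Suc[OF assms(1) hom_component_forms[OF assms(2)]]] by auto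
  then have "hom_component (Suc d) (\<Sum>e\<in>?D. x * hom_component e p)
      = (\<Sum>e\<in>?D. if e = d then x * hom_component d p else 0)"
    by (simp add: hom_component_sum)
  moreover have "(\<Sum>e\<in>?D. x * hom_component e p) = x * p"
    by (simp add: sum_hom_components[of p, symmetric] flip: sum_distrib_left)
  moreover have "hom_component d p = 0" if "d \<notin> ?D"
    using that by (intro poly_mapping_eqI) (auto simp: lookup_hom_component in_keys_iff when_def)
  ultimately show ?thesis by auto
qed

lemma mult_subspace_closed:
  assumes I: "mp.subspace I" and step: "\<And>x p. x \<in> forms r 1 \<Longrightarrow> p \<in> I \<Longrightarrow> x * p \<in> I"
    and "q \<in> carrier (mpoly_ring r)" "p \<in> I"
  shows "q * p \<in> I"
proof -
  have sub: "mp.subspace {q. q * p \<in> I}" for p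
    using I by (auto simp: mp.subspace_def distrib_right mult.assoc)
  have "mon m * p \<in> I" if "m \<in> expts r d" "p \<in> I" for m d p
    using that
  proof (induction d arbitrary: m p)
    case 0
    then show ?case by (simp add: expts_0)
  next
    case (Suc d)
    obtain i n where "i < r" "n \<in> expts r d" "m = Poly_Mapping.single i 1 + n"
      by (rule expts_Suc_split[OF Suc.prems(1)])
    moreover from this have "mon (Poly_Mapping.single i 1) \<in> (forms r 1 :: 'a mpoly set)"
      by (auto simp: mon_in_forms_iff expts_def)
    ultimately have "mon (Poly_Mapping.single i 1) * (mon n * p) \<in> I"
      using Suc.IH Suc.prems(2) step by blast
    moreover have "mon m * p = mon (Poly_Mapping.single i 1) * (mon n * p)"
      unfolding \<open>m = _\<close> by (simp add: mult_single flip: mult.assoc)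
    ultimately show ?case by (simp only:)
  qed
  then have "mon ` {m. Poly_Mapping.keys m \<subseteq> {..<r}} \<subseteq> {q. q * p \<in> I}"
    using assms(4) by (auto simp: expts_def)
  then show ?thesis
    using mp.span_minimal[OF _ sub] assms(3) unfolding carrier_eq_span by blast
qed

text \<open>Every monomial other than 1 has a variable as a factor, so membership in the socle can
  be tested on linear forms.\<close>

lemma mult_in_ideal:
  assumes "ideal I (mpoly_ring r)" "\<And>x. x \<in> forms r 1 \<Longrightarrow> x * p \<in> I"
    and m: "m \<in> carrier (mpoly_ring r)" "Poly_Mapping.lookup m 0 = 0"
  shows "m * p \<in> I"
proof -
  let ?M = "{m. Poly_Mapping.keys m \<subseteq> {..<r} \<and> m \<noteq> 0}"
  have "mp.subspace {q. q * p \<in> I}"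
    using ideal_subspace[OF assms(1)] by (auto simp: mp.subspace_def distrib_right mult.assoc)
  moreover have "mon m * p \<in> I" if m: "m \<in> ?M" for m
  proof -
    obtain d where "mdeg m = Suc d" using m by (cases "mdeg m") auto
    then have "m \<in> expts r (Suc d)" using m by (simp add: expts_def)
    then obtain i n where in_: "i < r" "n \<in> expts r d" "m = Poly_Mapping.single i 1 + n"
      by (rule expts_Suc_split)
    then have "mon (Poly_Mapping.single i 1) \<in> (forms r 1 :: 'a mpoly set)"
      by (auto simp: mon_in_forms_iff expts_def)
    then have "mon (Poly_Mapping.single i 1) * p \<in> I" by (rule assms(2))
    moreover have "mon n \<in> (carrier (mpoly_ring r) :: 'a mpoly set)"
      using in_(2) by (auto simp: carrier_eq expts_def)
    ultimately have "mon n * (mon (Poly_Mapping.single i 1) * p) \<in> I"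
      using ideal.I_l_closed[OF assms(1)] by simp
    moreover have "mon m = mon n * (mon (Poly_Mapping.single i 1) :: 'a mpoly)"
      by (simp add: in_(3) mult_single add.commute)
    ultimately show ?thesis by (simp only: mult.assoc)
  qed
  moreover have "m \<in> mp.span (mon ` ?M)"
    using m by (auto simp: in_span_mon_iff carrier_eq in_keys_iff)
  ultimately show ?thesis
    using mp.span_minimal[of "mon ` ?M" "{q. q * p \<in> I}"] by blast
qed

section \<open>From a level \<open>h\<close>-vector to a level pair\<close>

lemma level_h_vector_imp_level_pair:
  assumes "level_h_vector TYPE('k::field) [1, r, a, t]"
  obtains U2 U3 :: "'k::field mpoly set" where "level_pair r U2 U3"
    "mp.dim (forms r 2 :: 'k::field mpoly set) = mp.dim U2 + a"
    "mp.dim (forms r 3 :: 'k::field mpoly set) = mp.dim U3 + t"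
proof -
  obtain s and I :: "'k mpoly set" where sga: "standard_graded_artinian s I"
    and lev: "\<exists>t. level_of_type s I t" and hv: "h_vector s I = [1, r, a, t]"
    using assms unfolding level_h_vector_def by blast
  have hom: "\<And>p d. p \<in> I \<Longrightarrow> hom_component d p \<in> I" and I1: "I \<inter> forms s 1 = {0}"
    using sga by (auto simp: standard_graded_artinian_def homogeneous_ideal_def)
  have "ideal I (mpoly_ring s)" "I \<noteq> carrier (mpoly_ring s)"
    using sga by (simp_all add: standard_graded_artinian_def homogeneous_ideal_def)
  then interpret proper_ideal s I
    by (rule proper_ideal.intro)
  have "length (h_vector s I) = 4" using hv by simp
  then have sd: "socle_degree s I = 3" by (simp add: h_vector_def)
  have "map (hilb s I) [0, 1, 2, 3] = [1, r, a, t]"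
    using hv by (simp add: h_vector_def sd upt_rec numeral_eq_Suc)
  then have hilb: "hilb s I 1 = r" "hilb s I 2 = a" "hilb s I 3 = t" by auto
  have sr: "s = r"
  proof -
    have "mp.dim (I \<inter> forms s 1) = 0" unfolding I1 by (rule dim_zero)
    then show ?thesis
      using hilb(1) unfolding hilb_eq dim_forms card_expts_1 by simp
  qed
  have dim: "mp.dim (forms r d :: 'k mpoly set) = mp.dim (I \<inter> forms r d) + hilb s I d" for d
  proof -
    obtain B :: "'k mpoly set" where "finite B" "forms r d \<subseteq> mp.span B"
      by (rule forms_finite_span)
    then have "mp.dim (I \<inter> forms r d) \<le> mp.dim (forms r d :: 'k mpoly set)"
      by (intro mp.dim_mono_fin) auto
    then show ?thesis using hilb_eq[of d] unfolding sr by linarith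
  qed
  \<comment> \<open>The class of such a \<open>p\<close> is in the socle, so it equals the class of
    a cubic \<open>q\<close>. As \<open>d\<close> is not 3, the degree \<open>d\<close> component of
    \<open>p - q\<close> is \<open>p\<close> itself, and \<open>I\<close> is homogeneous.\<close>
  have faithful: "p \<in> I"
    if p: "p \<in> forms r d" "d \<noteq> 3" and x: "\<And>x. x \<in> forms r 1 \<Longrightarrow> x * p \<in> I" for p d
  proof -
    have pc: "p \<in> carrier (mpoly_ring s)" using p(1) forms_carrier sr by blast
    have "residue_class s I p \<in> socle s I"
      using socle_iff[OF pc] mult_in_ideal[OF ideal_I] x sr by simp
    then have "residue_class s I p \<in> graded_piece s I 3"
      using lev sd by (auto simp: level_of_type_def)
    then obtain q where q: "q \<in> forms s 3" "residue_class s I p = residue_class s I q"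
      by (auto simp: graded_piece_def)
    then have "p - q \<in> I" using residue_eq_iff[OF pc] forms_carrier by blast
    then have "hom_component d (p - q) \<in> I" by (rule hom)
    then show ?thesis
      using hom_component_of_form[OF p(1), of d] hom_component_of_form[OF q(1), of d] p(2)
      by (simp add: hom_component_diff)
  qed
  have mult: "x * p \<in> I" if "p \<in> I" "x \<in> forms r 1" for x p
    using mult_I[OF that(1)] that(2) forms_carrier sr by blast
  have "level_pair r (I \<inter> forms r 2) (I \<inter> forms r 3)"
    unfolding level_pair_def
  proof (intro conjI ballI impI)
    show "mp.subspace (I \<inter> forms r 2)" "mp.subspace (I \<inter> forms r 3)"
      by (intro mp.subspace_inter subspace_I subspace_forms)+
    fix p :: "'k mpoly" assume p: "p \<in> forms r 2"
    show "p \<in> I \<inter> forms r 2 \<longleftrightarrow> (\<forall>x\<in>forms r 1. x * p \<in> I \<inter> forms r 3)"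
      using p faithful[OF p] mult_forms_1_2[OF _ p] mult by auto
  next
    fix y :: "'k mpoly" assume y: "y \<in> forms r 1" "\<forall>x\<in>forms r 1. x * y \<in> I \<inter> forms r 2"
    then have "y \<in> I" using faithful[OF y(1)] by auto
    then show "y = 0" using I1 y(1) sr by blast
  qed auto
  then show thesis
    using dim[of 2] dim[of 3] unfolding hilb by (rule that)
qed

section \<open>From prescribed graded pieces back to a level algebra\<close>

locale graded_family =
  fixes r :: nat and L :: "nat \<Rightarrow> 'k::field mpoly set"
  assumes subspace_L: "\<And>d. mp.subspace (L d)"
    and L_forms: "\<And>d. L d \<subseteq> forms r d"
    and L_mult: "\<And>x p d. x \<in> forms r 1 \<Longrightarrow> p \<in> L d \<Longrightarrow> x * p \<in> L (Suc d)"
begin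

definition I :: "'k mpoly set"
  where "I = mp.span (\<Union>d. L d)"

lemma subspace_I: "mp.subspace I"
  by (simp add: I_def)

lemma L_I: "p \<in> L d \<Longrightarrow> p \<in> I"
  unfolding I_def by (intro mp.span_base) blast

lemma I_carrier: "I \<subseteq> carrier (mpoly_ring r)"
  unfolding I_def using L_forms forms_carrier by (intro mp.span_minimal subspace_carrier) blast

lemma hom_component_I: "p \<in> I \<Longrightarrow> hom_component d p \<in> L d"
  unfolding I_def
proof (induction rule: mp.span_induct_alt)
  case base
  then show ?case using mp.subspace_0[OF subspace_L] by simp
next
  case (step c x y)
  then obtain e where e: "x \<in> L e" by blast
  then have "hom_component d x = (if d = e then x else 0)"
    using hom_component_of_form L_forms by blast
  then have "hom_component d x \<in> L d"
    using e mp.subspace_0[OF subspace_L] by simp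
  then show ?case
    using step mp.subspace_add[OF subspace_L] mp.subspace_scale[OF subspace_L]
    by (simp add: hom_component_add hom_component_scale)
qed

lemma I_iff: "p \<in> I \<longleftrightarrow> (\<forall>d. hom_component d p \<in> L d)"
  using hom_component_I L_I subspace_of_components[OF subspace_I] by blast

lemma I_forms: "I \<inter> forms r d = L d"
proof (intro equalityI subsetI)
  fix p assume "p \<in> I \<inter> forms r d"
  then show "p \<in> L d" using hom_component_I[of p d] hom_component_of_form[of p r d d] by simp
next
  fix p assume "p \<in> L d"
  then show "p \<in> I \<inter> forms r d" using L_I L_forms by blast
qed

lemma mult_I:
  assumes "q \<in> carrier (mpoly_ring r)" "p \<in> I"
  shows "q * p \<in> I"
proof (rule mult_subspace_closed[OF subspace_I _ assms])
  fix x p :: "'k mpoly" assume x: "x \<in> forms r 1" and "p \<in> I"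
  from \<open>p \<in> I\<close> show "x * p \<in> I" unfolding I_def
  proof (induction rule: mp.span_induct_alt)
    case base
    then show ?case by (simp add: mp.span_zero)
  next
    case (step c y z)
    then have "x * y \<in> mp.span (\<Union>d. L d)" using L_mult x by (blast intro: mp.span_base)
    then have "pscale c (x * y) + x * z \<in> mp.span (\<Union>d. L d)"
      using step by (intro mp.span_add mp.span_scale)
    then show ?case by (simp add: distrib_left mult.left_commute)
  qed
qed

lemma ideal_I: "ideal I (mpoly_ring r)"
proof (rule idealI[OF mr.ring_axioms])
  show "subgroup I (add_monoid (mpoly_ring r))"
  proof (rule mr.add.subgroupI)
    show "I \<subseteq> carrier (mpoly_ring r)" by (rule I_carrier)
    show "I \<noteq> {}" using mp.subspace_0[OF subspace_I] by blast
    show "\<ominus>\<^bsub>mpoly_ring r\<^esub> p \<in> I" if "p \<in> I" for p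
      using that I_carrier mp.subspace_neg[OF subspace_I] by (subst mpoly_ring_uminus) auto
    show "p \<oplus>\<^bsub>mpoly_ring r\<^esub> q \<in> I" if "p \<in> I" "q \<in> I" for p q
      using that mp.subspace_add[OF subspace_I] by simp
  qed
  show "x \<otimes>\<^bsub>mpoly_ring r\<^esub> p \<in> I" if "p \<in> I" "x \<in> carrier (mpoly_ring r)" for p x
    using mult_I that by simp
  then show "p \<otimes>\<^bsub>mpoly_ring r\<^esub> x \<in> I" if "p \<in> I" "x \<in> carrier (mpoly_ring r)" for p x
    using that by (simp add: mult.commute)
qed

end

text \<open>\<open>L_high\<close> bounds the degree and puts all of degree \<open>e\<close> into the
  socle; \<open>L_level\<close> excludes socle elements in every other degree.\<close>

locale level_family = graded_family r L for r and L :: "nat \<Rightarrow> 'k::field mpoly set" +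
  fixes e :: nat
  assumes L_0: "L 0 = {0}" and L_1: "L 1 = {0}"
    and L_high: "\<And>d. e < d \<Longrightarrow> L d = forms r d"
    and L_socle_degree: "L e \<noteq> forms r e"
    and L_level: "\<And>d p. d \<noteq> e \<Longrightarrow> p \<in> forms r d \<Longrightarrow> (\<And>x. x \<in> forms r 1 \<Longrightarrow> x * p \<in> L (Suc d)) \<Longrightarrow> p \<in> L d"
begin

lemma one_notin: "1 \<notin> I"
proof
  assume "1 \<in> I"
  moreover have "(1 :: 'k mpoly) \<in> forms r 0"
    by (simp add: forms_eq expts_0)
  ultimately have "1 \<in> L 0" using I_forms by blast
  then show False using L_0 by simp
qed

sublocale quot: proper_ideal r I
proof (rule proper_ideal.intro)
  show "ideal I (mpoly_ring r)" by (rule ideal_I)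
  show "I \<noteq> carrier (mpoly_ring r)" using one_notin mr.one_closed[of r] by auto
qed

lemma artinian_quot: "artinian (quot_alg r I)"
proof (rule quot.res.S.finite_dimension_imp_artinian[OF quot.subfield_base])
  let ?F = "mp.span (\<Union>d\<le>e. forms r d) :: 'k mpoly set"
  let ?M = "\<Union>d\<le>e. expts r d"
  have F: "?F = mp.span (mon ` ?M)"
  proof (rule mp.span_unique)
    show "(\<Union>d\<le>e. forms r d) \<subseteq> mp.span (mon ` ?M)"
      unfolding forms_eq in_span_mon_iff subset_iff by blast
    fix S :: "'k mpoly set" assume "(\<Union>d\<le>e. forms r d) \<subseteq> S" "mp.subspace S"
    then show "mp.span (mon ` ?M) \<subseteq> S"
      using mon_in_forms_iff by (intro mp.span_minimal) blast+
  qed simp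
  have Fc: "?F \<subseteq> carrier (mpoly_ring r)"
    using forms_carrier by (intro mp.span_minimal subspace_carrier) blast
  have "carrier (quot_alg r I) = residue_class r I ` ?F"
  proof (intro equalityI subsetI)
    fix s assume "s \<in> carrier (quot_alg r I)"
    then obtain p where p: "p \<in> carrier (mpoly_ring r)" "s = residue_class r I p"
      by (auto simp: quot.carrier_quot)
    \<comment> \<open>Truncating \<open>p\<close> above degree \<open>e\<close> changes it only by
      forms that lie in \<open>I\<close>, so forms of bounded degree already represent every
      class.\<close>
    define q where "q = (\<Sum>d\<le>e. hom_component d p)"
    have "hom_component d p \<in> ?F" if "d \<le> e" for d
      using that hom_component_forms[OF p(1)] by (intro mp.span_base) blast
    then have q: "q \<in> ?F"
      unfolding q_def by (intro mp.span_sum) simp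
    have "hom_component d q = (\<Sum>d'\<le>e. if d' = d then hom_component d p else 0)" for d
      unfolding q_def hom_component_sum
      by (intro sum.cong) (auto simp: hom_component_of_form[OF hom_component_forms[OF p(1)]])
    then have "hom_component d q = (if d \<le> e then hom_component d p else 0)" for d
      by simp
    then have "hom_component d (p - q) \<in> L d" for d
      using L_high[of d] hom_component_forms[OF p(1), of d] mp.subspace_0[OF subspace_L]
      by (auto simp: hom_component_diff)
    then have "p - q \<in> I" by (simp add: I_iff)
    then have "s = residue_class r I q" using quot.residue_eq_iff p q Fc by blast
    then show "s \<in> residue_class r I ` ?F" using q by blast
  qed (use Fc quot.carrier_quot in blast)
  moreover have "quot.res.S.dimension (mp.dim ?F - mp.dim (I \<inter> ?F)) (base_field r I) (residue_class r I ` ?F)"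
  proof (rule quot.dimension_image[OF mp.subspace_span _ _ Fc])
    show "?F \<subseteq> mp.span (mon ` ?M)" using F by simp
    show "finite (mon ` ?M :: 'k mpoly set)" by (intro finite_imageI finite_UN_I finite_expts) simp
  qed
  ultimately show "quot.res.S.finite_dimension (base_field r I) (carrier (quot_alg r I))"
    using quot.res.S.finite_dimensionI by simp
qed

lemma hilb_L: "hilb r I d = mp.dim (forms r d :: 'k mpoly set) - mp.dim (L d)"
  by (simp add: quot.hilb_eq I_forms)

lemma hilb_pos: "0 < hilb r I e"
proof -
  obtain B :: "'k mpoly set" where "finite B" "forms r e \<subseteq> mp.span B"
    by (rule forms_finite_span)
  then have "\<not> mp.dim (forms r e :: 'k mpoly set) \<le> mp.dim (L e)"
    using mp.subspace_dim_eq_fin[OF subspace_L L_forms] L_socle_degree by blast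
  then show ?thesis by (simp add: hilb_L)
qed

lemma socle_degree: "socle_degree r I = e"
  unfolding socle_degree_def
proof (rule Greatest_equality)
  show "0 < hilb r I e" by (rule hilb_pos)
  fix d assume "0 < hilb r I d"
  then show "d \<le> e" using L_high[of d] by (cases "e < d") (simp_all add: hilb_L)
qed

text \<open>For a socle class represented by \<open>p\<close>, \<open>L_level\<close> applies to
  each homogeneous component separately and leaves only the one of degree \<open>e\<close>.\<close>

lemma socle: "socle r I = graded_piece r I e"
proof (intro equalityI subsetI)
  fix s assume s: "s \<in> socle r I"
  then have "s \<in> carrier (quot_alg r I)" by (simp add: socle_def)
  then obtain p where p: "p \<in> carrier (mpoly_ring r)" "s = residue_class r I p"
    by (auto simp: quot.carrier_quot)
  have xp: "x * p \<in> I" if "x \<in> forms r 1" for x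
  proof -
    have "Poly_Mapping.keys x \<subseteq> expts r 1" using that by (simp add: forms_eq)
    moreover have "0 \<notin> expts r 1" by (simp add: expts_def)
    ultimately have "Poly_Mapping.lookup x 0 = 0" by (auto simp: in_keys_iff)
    then show ?thesis using s quot.socle_iff[OF p(1)] p(2) that forms_carrier by blast
  qed
  have L: "hom_component d p \<in> L d" if "d \<noteq> e" for d
    using L_level[OF that hom_component_forms[OF p(1)]] hom_component_I[OF xp, of _ "Suc d"]
      hom_component_mult[OF _ p(1)] by simp
  let ?q = "hom_component e p"
  have q: "?q \<in> forms r e" by (rule hom_component_forms[OF p(1)])
  have "hom_component d (p - ?q) \<in> L d" for d
    using L hom_component_of_form[OF q, of d] mp.subspace_0[OF subspace_L]
    by (auto simp: hom_component_diff)
  then have "p - ?q \<in> I" by (simp add: I_iff)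
  then have "s = residue_class r I ?q" using quot.residue_eq_iff p q forms_carrier by blast
  then show "s \<in> graded_piece r I e" using q by (simp add: graded_piece_def)
next
  fix s assume "s \<in> graded_piece r I e"
  then obtain p where p: "p \<in> forms r e" "s = residue_class r I p"
    by (auto simp: graded_piece_def)
  have "x * p \<in> I" if "x \<in> forms r 1" for x
    using mult_in_forms_Suc[OF that p(1)] L_high[of "Suc e"] by (intro L_I[of _ "Suc e"]) simp
  then have "\<forall>m\<in>carrier (mpoly_ring r). Poly_Mapping.lookup m 0 = 0 \<longrightarrow> m * p \<in> I"
    using mult_in_ideal[OF ideal_I] by blast
  then show "s \<in> socle r I" using quot.socle_iff p forms_carrier by blast
qed

lemma level_h_vector_family: "level_h_vector TYPE('k) (map (hilb r I) [0..<Suc e])"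
  unfolding level_h_vector_def
proof (intro exI conjI)
  show "standard_graded_artinian r I"
    unfolding standard_graded_artinian_def homogeneous_ideal_def
    using ideal_I hom_component_I L_I quot.proper I_forms[of 1] L_1 artinian_quot by auto
  show "level_of_type r I (hilb r I e)"
    by (simp add: level_of_type_def socle socle_degree hilb_def)
  show "h_vector r I = map (hilb r I) [0..<Suc e]"
    by (simp add: h_vector_def socle_degree)
qed

end

lemma level_pair_imp_level_h_vector:
  fixes U2 U3 :: "'k::field mpoly set"
  assumes level: "level_pair r U2 U3" and "0 < t"
    and dims: "mp.dim (forms r 2 :: 'k mpoly set) = mp.dim U2 + a"
      "mp.dim (forms r 3 :: 'k mpoly set) = mp.dim U3 + t"
  shows "level_h_vector TYPE('k) [1, r, a, t]"
proof -
  \<comment> \<open>The ideal is zero below degree 2 and contains all forms above degree 3, so socle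
    in degrees 1 and 2 is governed by \<open>level_pair\<close> alone.\<close>
  define L where "L d = (if d = 2 then U2 else if d = 3 then U3 else if 3 < d then forms r d else {0})" for d
  have L: "L 0 = {0}" "L 1 = {0}" "L 2 = U2" "L 3 = U3" "\<And>d. 3 < d \<Longrightarrow> L d = forms r d"
    by (simp_all add: L_def)
  have lev: "mp.subspace U2" "mp.subspace U3" "U2 \<subseteq> forms r 2" "U3 \<subseteq> forms r 3"
    "\<And>p. p \<in> forms r 2 \<Longrightarrow> p \<in> U2 \<longleftrightarrow> (\<forall>x\<in>forms r 1. x * p \<in> U3)"
    "\<And>y. y \<in> forms r 1 \<Longrightarrow> (\<forall>x\<in>forms r 1. x * y \<in> U2) \<Longrightarrow> y = 0"
    using level by (auto simp: level_pair_def)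
  have zero: "{0} \<subseteq> (forms r d :: 'k mpoly set)" for d
    using mp.subspace_0[OF subspace_forms] by blast
  \<comment> \<open>A variable must exist to show that nonzero constants are not in the socle;
    without variables there would be no cubics, contrary to \<open>0 < t\<close>.\<close>
  have "r \<noteq> 0"
  proof
    assume "r = 0"
    then have "expts r 3 = {}" by (auto simp: expts_def)
    then show False using dims(2) \<open>0 < t\<close> by (simp add: dim_forms)
  qed
  have subspace: "mp.subspace (L d)" for d
    using lev subspace_forms mp.subspace_single_0 by (auto simp: L_def)
  interpret level_family r L 3
  proof
    show "mp.subspace (L d)" for d by (rule subspace)
    show "L d \<subseteq> forms r d" for d
      using lev zero[of d] by (auto simp: L_def)
    show "x * p \<in> L (Suc d)" if "x \<in> forms r 1" "p \<in> L d" for x p d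
    proof -
      consider "d < 2" | "d = 2" | "d = 3" | "3 < d" by linarith
      then show ?thesis
      proof cases
        case 1
        then have "p = 0" using that by (simp add: L_def)
        then show ?thesis using mp.subspace_0[OF subspace] by simp
      next
        case 2
        then show ?thesis using that lev L by (auto simp: L_def)
      next
        case 3
        then show ?thesis using mult_in_forms_Suc[of x r p 3] that lev L by auto
      next
        case 4
        then show ?thesis using mult_in_forms_Suc[of x r p d] that L by auto
      qed
    qed
    show "L 3 \<noteq> forms r 3" using dims(2) \<open>0 < t\<close> L by auto
    show "p \<in> L d" if d: "d \<noteq> 3" and p: "p \<in> forms r d" and x: "\<And>x. x \<in> forms r 1 \<Longrightarrow> x * p \<in> L (Suc d)" for d p
    proof -
      consider "d = 0" | "d = 1" | "d = 2" | "3 < d" using d by linarith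
      then show ?thesis
      proof cases
        case 1
        then obtain c where c: "p = pscale c 1"
          using p poly_eq_sum_mon[of "{0}" p] by (auto simp: forms_eq expts_0)
        let ?x = "mon (Poly_Mapping.single 0 1) :: 'k mpoly"
        have "?x \<in> forms r 1" using \<open>r \<noteq> 0\<close> by (auto simp: mon_in_forms_iff expts_def)
        then have "?x * p = 0" using x L 1 by auto
        then have "pscale c ?x = 0" by (simp only: c mult.commute mult_1_left)
        moreover have "?x \<noteq> 0" by (metis lookup_single_eq lookup_zero one_neq_zero)
        ultimately have "c = 0" using mp.scale_eq_0_iff[of c ?x] by blast
        then show ?thesis using c L 1 by simp
      next
        case 2
        then show ?thesis using lev(6)[of p] p x L by (auto simp: numeral_2_eq_2)
      next
        case 3
        then show ?thesis using lev(5)[of p] p x L by (auto simp: numeral_3_eq_3 numeral_2_eq_2)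
      next
        case 4
        then show ?thesis using p L by simp
      qed
    qed
  qed (use L in auto)
  have "hilb r I 0 = 1" "hilb r I 1 = r" "hilb r I 2 = a" "hilb r I 3 = t"
    using L dims by (simp_all add: hilb_L dim_forms expts_0 card_expts_1[simplified] dim_zero)
  moreover have "[0..<Suc 3] = [0, 1, 2, 3]" by (simp add: upt_rec)
  ultimately have "map (hilb r I) [0..<Suc 3] = [1, r, a, t]"
    by (simp only: list.map)
  then show ?thesis using level_h_vector_family by (simp only:)
qed

section \<open>The inequalities and the conclusion\<close>

lemma numerical_cases:
  fixes r a t :: nat
  assumes "0 < t" and "int t * (int r - 2 * int t) + 3 \<le> int a"
    and "int r \<ge> int t * (int a - int t) + 2"
  shows "a < t \<or> a = t \<and> 2 \<le> r \<or> a = Suc t \<and> t + 2 \<le> r"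
proof (cases "a \<le> Suc t")
  case True
  then consider "a < t" | "a = t" | "a = Suc t" by linarith
  then show ?thesis using assms(3) by cases auto
next
  case False
  \<comment> \<open>The excess of \<open>a\<close> over \<open>t + 1\<close>, less one. Inserting
    the lower bound for \<open>r\<close> into the one for \<open>a\<close> yields
    \<open>t * t * e + t + 1 \<le> e\<close>, impossible for positive \<open>t\<close> and
    nonnegative \<open>e\<close>.\<close>
  define e where "e = int a - int t - 2"
  have e: "0 \<le> e" "int a - int t = e + 2" using False by (auto simp: e_def)
  have "int t * (int t * (e + 2) + 2 - 2 * int t) \<le> int t * (int r - 2 * int t)"
    using assms(1,3) unfolding e(2) by (intro mult_left_mono) auto
  then have "int t * (int t * (e + 2) + 2 - 2 * int t) + 3 \<le> int t + 2 + e"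
    using assms(2) e(2) by linarith
  then have "int t * int t * e + int t + 1 \<le> e" by (simp add: algebra_simps)
  moreover have "1 * e \<le> int t * int t * e"
    using assms(1) e(1) by (intro mult_right_mono) (auto simp: Suc_le_eq int_one_le_iff_zero_less)
  ultimately show ?thesis by linarith
qed

theorem theorem3p5:
  fixes r a t :: nat
  assumes "level_h_vector TYPE('k::field_char_0) [1, r, a, t]"
    and "int t * (int r - 2 * int t) + 3 \<le> int a"
    and "int a \<le> int ((r + 1) choose 2) - 1"
    and "int r \<ge> int t * (int a - int t) + 2"
  shows "level_h_vector TYPE('k) [1, r, a + 1, t]"
proof -
  obtain U2 U3 :: "'k mpoly set" where level: "level_pair r U2 U3"
    and dims: "mp.dim (forms r 2 :: 'k mpoly set) = mp.dim U2 + a"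
      "mp.dim (forms r 3 :: 'k mpoly set) = mp.dim U3 + t"
    by (rule level_h_vector_imp_level_pair[OF assms(1)])
  have sub: "mp.subspace U2" "mp.subspace U3" "U2 \<subseteq> forms r 2" "U3 \<subseteq> forms r 3"
    and U2_iff: "\<And>p. p \<in> forms r 2 \<Longrightarrow> p \<in> U2 \<longleftrightarrow> (\<forall>x\<in>forms r 1. x * p \<in> U3)"
    using level by (auto simp: level_pair_def)
  \<comment> \<open>For \<open>t = 0\<close> all cubics lie in \<open>U3\<close>, hence all quadrics
    in \<open>U2\<close>, so \<open>a = 0\<close>; but the lower bound on \<open>a\<close> would
    then read \<open>3 \<le> a\<close>.\<close>
  have t: "0 < t"
  proof (rule ccontr)
    assume "\<not> 0 < t"
    then have t0: "t = 0" by simp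
    obtain B :: "'k mpoly set" where "finite B" "forms r 3 \<subseteq> mp.span B"
      by (rule forms_finite_span)
    then have "U3 = forms r 3"
      using mp.subspace_dim_eq_fin[OF sub(2,4)] dims(2) t0 by simp
    then have "U2 = forms r 2" using U2_iff mult_forms_1_2 sub(3) by blast
    then have "a = 0" using dims(1) by simp
    then show False using assms(2) t0 by simp
  qed
  have "(r + 1) choose 2 \<noteq> 0" using assms(3) by linarith
  then have "a < (r + 1) choose 2" using assms(3) by linarith
  \<comment> \<open>The upper bound on \<open>a\<close> leaves room for a nonzero quadric in
    \<open>U2\<close>, the source of the evaluation point.\<close>
  then have "a < mp.dim (forms r 2 :: 'k mpoly set)"
    using card_expts_2[of r] by (simp only: dim_forms)
  then have "U2 \<noteq> {0}" using dims(1) by (auto simp: dim_zero)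
  then obtain V2 V3 :: "'k mpoly set" where "level_pair r V2 V3"
    "mp.dim (forms r 2 :: 'k mpoly set) = mp.dim V2 + Suc a"
    "mp.dim (forms r 3 :: 'k mpoly set) = mp.dim V3 + t"
    using level_pair_step[OF level _ dims t numerical_cases[OF t assms(2,4)]] by blast
  then have "level_h_vector TYPE('k) [1, r, Suc a, t]"
    by (intro level_pair_imp_level_h_vector[OF _ t])
  then show ?thesis by simp
qed

end
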